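(* Let $p$ be a prime and let $F$ be a finitely generated free group. Then the action of $F$ by left multiplication on its pro-$p$ completion (with normalized Haar measure) is weakly equivalent to the action of $F$ by left multiplication on its pro-(finite solvable) completion (with normalized Haar measure).
   Context: The pro-$p$ completion is the inverse limit of $F/N$ over normal subgroups $N$ of $p$-power index; the pro-(finite solvable) completion is the inverse limit of $F/N$ over normal subgroups $N$ with $F/N$ finite solvable. Weak containment: an action $f$ on $(X,\mu)$ weakly contains $g$ on $(Y,\nu)$ if for all measurable $A_1,\dots,A_n\subseteq Y$, finite $E\subseteq F$ and $\varepsilon>0$ there are measurable $B_1,\dots,B_n\subseteq X$ with $|\mu(B_i^\gamma\cap B_j)-\nu(A_i^\gamma\cap A_j)|<\varepsilon$ for all $i,j\le n$, $\gamma\in E$ (with $A^\gamma$ the image of $A$ under $\gamma$); weak equivalence means weak containment in both directions. *)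

theory Defs
  imports "HOL-Algebra.Solvable_Groups" "HOL-Probability.Probability"
begin

text \<open>A letter is (generator index, sign); (i, True) is x_i, (i, False) its inverse.\<close>

fun reduce :: "(nat \<times> bool) list \<Rightarrow> (nat \<times> bool) list" where
  "reduce [] = []"
| "reduce (x # xs) =
     (case reduce xs of
        [] \<Rightarrow> [x]
      | y # ys \<Rightarrow> (if fst x = fst y \<and> snd x \<noteq> snd y then ys else x # y # ys))"

definition free_group :: "nat \<Rightarrow> (nat \<times> bool) list monoid" where
  "free_group n =
     \<lparr> partial_object.carrier = {xs. set xs \<subseteq> {..<n} \<times> UNIV \<and> reduce xs = xs},
       monoid.mult = (\<lambda>xs ys. reduce (xs @ ys)),
       monoid.one = [] \<rparr>"

definition p_index_normal :: "('a, 'b) monoid_scheme \<Rightarrow> nat \<Rightarrow> 'a set set" where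
  "p_index_normal G p = {N. N \<lhd> G \<and> (\<exists>k. card (rcosets\<^bsub>G\<^esub> N) = p ^ k)}"

definition solv_normal :: "('a, 'b) monoid_scheme \<Rightarrow> 'a set set" where
  "solv_normal G = {N. N \<lhd> G \<and> finite (carrier (G Mod N)) \<and> solvable (G Mod N)}"

definition completion :: "('a, 'b) monoid_scheme \<Rightarrow> 'a set set \<Rightarrow> ('a set \<Rightarrow> 'a set) set" where
  "completion G \<N> =
     {x \<in> \<N> \<rightarrow>\<^sub>E UNIV.
        (\<forall>N\<in>\<N>. x N \<in> rcosets\<^bsub>G\<^esub> N) \<and>
        (\<forall>N\<in>\<N>. \<forall>M\<in>\<N>. N \<subseteq> M \<longrightarrow> x N \<subseteq> x M)}"

definition comp_act :: "('a, 'b) monoid_scheme \<Rightarrow> 'a set set \<Rightarrow> 'a \<Rightarrow> ('a set \<Rightarrow> 'a set) \<Rightarrow> ('a set \<Rightarrow> 'a set)" where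
  "comp_act G \<N> g x = (\<lambda>N. if N \<in> \<N> then l_coset G g (x N) else undefined)"

definition cylinders :: "('a, 'b) monoid_scheme \<Rightarrow> 'a set set \<Rightarrow> ('a set \<Rightarrow> 'a set) set set" where
  "cylinders G \<N> = {{x \<in> completion G \<N>. x N = c} | N c. N \<in> \<N> \<and> c \<in> rcosets\<^bsub>G\<^esub> N}"

text \<open>Normalized Haar measure on the completion: the probability measure on the
  Borel (= generated by the basic clopen cylinders) sigma-algebra giving each
  cylinder over N the mass 1/[G:N].\<close>
definition is_haar :: "('a, 'b) monoid_scheme \<Rightarrow> 'a set set \<Rightarrow> ('a set \<Rightarrow> 'a set) measure \<Rightarrow> bool" where
  "is_haar G \<N> M \<longleftrightarrow>
     prob_space M \<and> space M = completion G \<N> \<and>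
     sets M = sigma_sets (completion G \<N>) (cylinders G \<N>) \<and>
     (\<forall>N\<in>\<N>. \<forall>c\<in>rcosets\<^bsub>G\<^esub> N.
        measure M {x \<in> completion G \<N>. x N = c} = 1 / real (card (rcosets\<^bsub>G\<^esub> N)))"

definition haar :: "('a, 'b) monoid_scheme \<Rightarrow> 'a set set \<Rightarrow> ('a set \<Rightarrow> 'a set) measure" where
  "haar G \<N> = (SOME M. is_haar G \<N> M)"

definition weakly_contains ::
  "('g, 'c) monoid_scheme \<Rightarrow> ('g \<Rightarrow> 'x \<Rightarrow> 'x) \<Rightarrow> 'x measure \<Rightarrow>
   ('g \<Rightarrow> 'y \<Rightarrow> 'y) \<Rightarrow> 'y measure \<Rightarrow> bool" where
  "weakly_contains G f M g N \<longleftrightarrow>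
     (\<forall>n (A :: nat \<Rightarrow> 'y set). (\<forall>i<n. A i \<in> sets N) \<longrightarrow>
       (\<forall>E. E \<subseteq> carrier G \<and> finite E \<longrightarrow>
         (\<forall>\<epsilon>>0. \<exists>B :: nat \<Rightarrow> 'x set. (\<forall>i<n. B i \<in> sets M) \<and>
            (\<forall>i<n. \<forall>j<n. \<forall>\<gamma>\<in>E.
               \<bar>measure M (f \<gamma> ` B i \<inter> B j) - measure N (g \<gamma> ` A i \<inter> A j)\<bar> < \<epsilon>))))"

definition weakly_equivalent ::
  "('g, 'c) monoid_scheme \<Rightarrow> ('g \<Rightarrow> 'x \<Rightarrow> 'x) \<Rightarrow> 'x measure \<Rightarrow>
   ('g \<Rightarrow> 'y \<Rightarrow> 'y) \<Rightarrow> 'y measure \<Rightarrow> bool" where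
  "weakly_equivalent G f M g N \<longleftrightarrow> weakly_contains G f M g N \<and> weakly_contains G g N f M"

end

theory Submission
  imports Defs "HOL-Computational_Algebra.Primes" "HOL-Algebra.Group_Action" "HOL-Algebra.FiniteProduct"
begin

text \<open>
  Pro-p quotients are finite solvable quotients, so the pro-solvable action factors onto the pro-p
  action and one direction is immediate. For the other direction it suffices to approximate every
  finite solvable quotient \<open>F/N\<close> by finite \<open>p\<close>-quotients: for each \<open>\<epsilon>\<close> there is a normal
  subgroup \<open>K\<close> of \<open>p\<close>-power index and a map \<open>F/K \<rightarrow> F/N\<close> that commutes with each generator outside
  a set of density \<open>\<epsilon>\<close>; by transitivity of \<open>F/N\<close> such a map almost preserves the uniform measure.

  The map is built along the derived series. Suppose \<open>N \<le> L\<close> with \<open>L/N\<close> abelian and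
  \<open>\<phi> : F/K \<rightarrow> F/L\<close> is almost equivariant. The extension \<open>F/N\<close> of \<open>F/L\<close> is described by a cocycle
  with values in \<open>A = L/N\<close>; pull it back along \<open>\<phi>\<close> and lift it from \<open>A\<close> to the free abelian
  group on \<open>A\<close>, which is possible because \<open>F\<close> is free. Reducing modulo a large power \<open>q\<close> of \<open>p\<close>
  gives a homomorphism from \<open>F\<close> to the \<open>p\<close>-group \<open>W\<close>, the wreath product of \<open>(\<int>/q)\<close>-vectors by
  \<open>F/K\<close>. Sending residues to their representatives in \<open>[0, q)\<close> and multiplying out in \<open>A\<close> defines a
  map \<open>W \<rightarrow> F/N\<close> that fails to be equivariant only where \<open>\<phi>\<close> does or where a coordinate wraps around
  modulo \<open>q\<close>, an event of density \<open>1/q\<close>. One of the right cosets of the image of \<open>F\<close> in \<open>W\<close> does at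
  least as well as the average.
\<close>

no_notation subset_mset (infix \<open><#\<close> 50)

section \<open>Haar measure on profinite completions\<close>

text \<open>Every fibre is a right translate of the kernel, so a preimage has \<open>card S\<close>
  times the kernel's size. Taking \<open>S\<close> to be all of \<open>H\<close> eliminates that
  size; the product form avoids division in the naturals.\<close>

lemma card_hom_vimage:
  assumes "group_hom G H h" "h ` carrier G = carrier H" "finite (carrier G)" "S \<subseteq> carrier H"
  shows "card {x \<in> carrier G. h x \<in> S} * card (carrier H) = card S * card (carrier G)"
proof -
  interpret group_hom G H h by fact
  have fH: "finite (carrier H)" using assms(2,3) by (metis finite_imageI)
  have fibre: "card {x \<in> carrier G. h x = d} = card (kernel G H h)" if d: "d \<in> carrier H" for d
  proof -
    obtain g where g: "g \<in> carrier G" "h g = d" using d assms(2) by (metis imageE)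
    have "bij_betw (\<lambda>x. x \<otimes>\<^bsub>G\<^esub> g) (kernel G H h) {x \<in> carrier G. h x = d}"
    proof (rule bij_betw_byWitness[where f' = "\<lambda>x. x \<otimes>\<^bsub>G\<^esub> inv\<^bsub>G\<^esub> g"])
      show "(\<lambda>x. x \<otimes>\<^bsub>G\<^esub> inv\<^bsub>G\<^esub> g) ` {x \<in> carrier G. h x = d} \<subseteq> kernel G H h"
        using g by (auto simp: kernel_def)
    qed (use g in \<open>auto simp: kernel_def G.m_assoc\<close>)
    then show ?thesis by (simp add: bij_betw_same_card)
  qed
  have count: "card {x \<in> carrier G. h x \<in> S} = card S * card (kernel G H h)" if S: "S \<subseteq> carrier H" for S
  proof -
    have "{x \<in> carrier G. h x \<in> S} = (\<Union>d\<in>S. {x \<in> carrier G. h x = d})" by auto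
    also have "card \<dots> = (\<Sum>d\<in>S. card {x \<in> carrier G. h x = d})"
      by (rule card_UN_disjoint) (use S fH assms(3) finite_subset in auto)
    also have "\<dots> = (\<Sum>d\<in>S. card (kernel G H h))"
      by (rule sum.cong) (use S fibre in auto)
    finally show ?thesis by simp
  qed
  have "{x \<in> carrier G. h x \<in> carrier H} = carrier G" by auto
  then show ?thesis using count[OF assms(4)] count[of "carrier H"] by (simp add: mult_ac)
qed

context group
begin

lemma rcosets_obtain:
  assumes "c \<in> rcosets N" obtains g where "g \<in> carrier G" "c = N #> g"
  using assms by (auto simp: RCOSETS_def)

text \<open>The map \<open>c \<mapsto> N <#> c\<close> serves throughout as the projection
  \<open>G/K \<rightarrow> G/N\<close>; it is computed on representatives because
  \<open>N <#> K = N\<close>.\<close>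

lemma set_mult_r_coset_sub:
  assumes "subgroup N G" "subgroup K G" "K \<subseteq> N" "g \<in> carrier G"
  shows "N <#> (K #> g) = N #> g"
proof -
  interpret N: subgroup N G by fact
  interpret K: subgroup K G by fact
  have "N <#> (K #> g) = (N <#> K) #> g"
    by (rule setmult_rcos_assoc) (use assms N.subset K.subset in auto)
  also have "N <#> K = N"
  proof
    show "N <#> K \<subseteq> N" using assms(3) by (auto simp: set_mult_def)
    show "N \<subseteq> N <#> K"
    proof
      fix x assume "x \<in> N"
      then have "x = x \<otimes> \<one>" by simp
      then show "x \<in> N <#> K" using \<open>x \<in> N\<close> K.one_closed unfolding set_mult_def by blast
    qed
  qed
  finally show ?thesis .
qed

lemma l_coset_rcoset:
  assumes "N \<lhd> G" "g \<in> carrier G" "h \<in> carrier G"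
  shows "g <# (N #> h) = N #> (g \<otimes> h)"
proof -
  interpret normal N G by fact
  have "g <# (N #> h) = (g <# N) #> h" using coset_assoc assms subset by simp
  also have "g <# N = N #> g" using coset_eq assms by simp
  finally show ?thesis using coset_mult_assoc assms subset by simp
qed

lemma card_coset_preimage:
  assumes "N \<lhd> G" "K \<lhd> G" "K \<subseteq> N" "finite (rcosets K)" "S \<subseteq> rcosets N"
  shows "card {c \<in> rcosets K. N <#> c \<in> S} * card (rcosets N) = card S * card (rcosets K)"
proof -
  interpret N: normal N G by fact
  interpret K: normal K G by fact
  have r: "N <#> (K #> g) = N #> g" if "g \<in> carrier G" for g
    using set_mult_r_coset_sub[OF N.subgroup_axioms K.subgroup_axioms assms(3) that] .
  interpret gh: group_hom "G Mod K" "G Mod N" "\<lambda>c. N <#> c"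
    by (intro group_hom.intro group_hom_axioms.intro K.factorgroup_is_group N.factorgroup_is_group)
       (auto simp: hom_def carrier_FactGroup r N.rcos_sum K.rcos_sum)
  have "card {c \<in> carrier (G Mod K). N <#> c \<in> S} * card (carrier (G Mod N)) = card S * card (carrier (G Mod K))"
    by (rule card_hom_vimage[OF gh.group_hom_axioms])
       (use assms in \<open>auto simp: carrier_FactGroup image_image r RCOSETS_def UNION_singleton_eq_range\<close>)
  then show ?thesis by (simp add: FactGroup_def)
qed

end

section \<open>Cylinder sets and their density\<close>

text \<open>What the \<open>p\<close>-power family and the finite solvable family have in common.
  Closure under intersection makes the quotients a directed system, so finitely many cylinders can
  be read at one level.\<close>

locale profinite_family = group G for G (structure) +
  fixes \<N> :: "'a set set"
  assumes nonempty: "\<N> \<noteq> {}"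
    and normal: "N \<in> \<N> \<Longrightarrow> N \<lhd> G"
    and finite_index: "N \<in> \<N> \<Longrightarrow> finite (rcosets N)"
    and Int_closed: "N \<in> \<N> \<Longrightarrow> K \<in> \<N> \<Longrightarrow> N \<inter> K \<in> \<N>"
begin

definition cyl :: "'a set \<Rightarrow> 'a set set \<Rightarrow> ('a set \<Rightarrow> 'a set) set" where
  "cyl N S = {x \<in> completion G \<N>. x N \<in> S}"

definition cyl_algebra :: "('a set \<Rightarrow> 'a set) set set" where
  "cyl_algebra = {cyl N S | N S. N \<in> \<N> \<and> S \<subseteq> rcosets N}"

lemma family_subgroup: "N \<in> \<N> \<Longrightarrow> subgroup N G"
  by (rule normal_imp_subgroup[OF normal])

lemma index_pos: "N \<in> \<N> \<Longrightarrow> 0 < card (rcosets N)"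
  unfolding card_gt_0_iff using subgroup.subgroup_in_rcosets[OF family_subgroup is_group] finite_index by blast

lemma completion_rcosets: "x \<in> completion G \<N> \<Longrightarrow> N \<in> \<N> \<Longrightarrow> x N \<in> rcosets N"
  unfolding completion_def by blast

text \<open>Links the inclusion condition in \<open>completion\<close> to projection maps: a
  representative of \<open>x K\<close> also lies in \<open>x N\<close>, and a coset of
  \<open>N\<close> is determined by any of its elements.\<close>

lemma completion_proj:
  assumes "x \<in> completion G \<N>" "N \<in> \<N>" "K \<in> \<N>" "K \<subseteq> N"
  shows "x N = N <#> x K"
proof -
  interpret N: subgroup N G using family_subgroup assms by auto
  interpret K: subgroup K G using family_subgroup assms by auto
  obtain g where g: "g \<in> carrier G" "x K = K #> g"
    using rcosets_obtain[OF completion_rcosets[OF assms(1,3)]] .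
  have "g \<in> x K" using g rcos_self K.subgroup_axioms by simp
  moreover have "x K \<subseteq> x N" using assms unfolding completion_def by blast
  ultimately have "g \<in> x N" by blast
  moreover obtain h where h: "h \<in> carrier G" "x N = N #> h"
    using rcosets_obtain[OF completion_rcosets[OF assms(1,2)]] .
  ultimately have "x N = N #> g"
    using repr_independence[of g N h] N.subgroup_axioms by simp
  then show ?thesis
    using set_mult_r_coset_sub[OF N.subgroup_axioms K.subgroup_axioms assms(4) g(1)] g(2) by simp
qed

lemma completion_iff:
  "x \<in> completion G \<N> \<longleftrightarrow>
    x \<in> (\<Pi>\<^sub>E N\<in>\<N>. rcosets N) \<and> (\<forall>N\<in>\<N>. \<forall>M\<in>\<N>. N \<subseteq> M \<longrightarrow> x N \<subseteq> x M)"
  by (auto simp: completion_def PiE_iff)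

lemma rcoset_mono: "N \<subseteq> M \<Longrightarrow> N #> g \<subseteq> M #> g"
  by (auto simp: r_coset_def)

lemma embed_completion:
  "g \<in> carrier G \<Longrightarrow> (\<lambda>N\<in>\<N>. N #> g) \<in> completion G \<N>"
  by (auto simp: completion_iff RCOSETS_def rcoset_mono)

lemma completion_attains:
  assumes "N \<in> \<N>" "c \<in> rcosets N" obtains x where "x \<in> completion G \<N>" "x N = c"
proof -
  obtain g where "g \<in> carrier G" "c = N #> g" using rcosets_obtain assms(2) by blast
  then show ?thesis using that[OF embed_completion] assms(1) by simp
qed

lemma cyl_refine:
  assumes "N \<in> \<N>" "K \<in> \<N>" "K \<subseteq> N"
  shows "cyl N S = cyl K {c \<in> rcosets K. N <#> c \<in> S}"
  unfolding cyl_def using completion_proj[OF _ assms] completion_rcosets[OF _ assms(2)]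
  by (intro Collect_cong) auto

text \<open>Every coset of \<open>N\<close> is the \<open>N\<close>-coordinate of some point of the
  completion, namely of the image of a group element.\<close>

lemma cyl_inj:
  assumes "N \<in> \<N>" "S \<subseteq> rcosets N" "T \<subseteq> rcosets N" "cyl N S = cyl N T"
  shows "S = T"
proof -
  have "c \<in> S \<longleftrightarrow> c \<in> T" if c: "c \<in> rcosets N" for c
  proof -
    obtain x where "x \<in> completion G \<N>" "x N = c" using completion_attains[OF assms(1) c] .
    moreover from this have "x \<in> cyl N S \<longleftrightarrow> c \<in> S" "x \<in> cyl N T \<longleftrightarrow> c \<in> T" by (simp_all add: cyl_def)
    ultimately show ?thesis using assms(4) by simp
  qed
  then show ?thesis using assms(2,3) by blast
qed

lemma refine_density:
  assumes "N \<in> \<N>" "K \<in> \<N>" "K \<subseteq> N" "S \<subseteq> rcosets N"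
  shows "card {c \<in> rcosets K. N <#> c \<in> S} / card (rcosets K) = card S / card (rcosets N)"
proof -
  have "real (card {c \<in> rcosets K. N <#> c \<in> S} * card (rcosets N)) = real (card S * card (rcosets K))"
    using card_coset_preimage[OF normal[OF assms(1)] normal[OF assms(2)] assms(3) finite_index[OF assms(2)] assms(4)]
    by presburger
  then show ?thesis using index_pos[OF assms(1)] index_pos[OF assms(2)] by (simp add: divide_simps)
qed

text \<open>Both descriptions are refined to the level \<open>N \<inter> K\<close>, where the
  describing sets of cosets must agree by \<open>cyl_inj\<close>; refinement does not change the
  density.\<close>

lemma cyl_density_unique:
  assumes "N \<in> \<N>" "K \<in> \<N>" "S \<subseteq> rcosets N" "T \<subseteq> rcosets K" "cyl N S = cyl K T"
  shows "card S / card (rcosets N) = card T / card (rcosets K)"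
proof -
  let ?L = "N \<inter> K"
  have L: "?L \<in> \<N>" using Int_closed assms by auto
  have "{c \<in> rcosets ?L. N <#> c \<in> S} = {c \<in> rcosets ?L. K <#> c \<in> T}"
  proof (rule cyl_inj[OF L])
    show "cyl ?L {c \<in> rcosets ?L. N <#> c \<in> S} = cyl ?L {c \<in> rcosets ?L. K <#> c \<in> T}"
      using cyl_refine[OF assms(1) L, of S] cyl_refine[OF assms(2) L, of T] assms(5) by simp
  qed auto
  then show ?thesis
    using refine_density[OF assms(1) L _ assms(3)] refine_density[OF assms(2) L _ assms(4)] by simp
qed

text \<open>A cylinder set can be described at many levels; the definite description is legitimate
  by \<open>cyl_density_unique\<close>.\<close>

definition density :: "('a set \<Rightarrow> 'a set) set \<Rightarrow> real" where
  "density A = (THE r. \<exists>N\<in>\<N>. \<exists>S\<subseteq>rcosets N. A = cyl N S \<and> r = card S / card (rcosets N))"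

lemma density_cyl:
  assumes "N \<in> \<N>" "S \<subseteq> rcosets N"
  shows "density (cyl N S) = card S / card (rcosets N)"
  unfolding density_def
proof (rule the_equality)
  show "\<exists>N'\<in>\<N>. \<exists>S'\<subseteq>rcosets N'. cyl N S = cyl N' S' \<and> card S / card (rcosets N) = card S' / card (rcosets N')"
    using assms by blast
next
  fix r assume "\<exists>N'\<in>\<N>. \<exists>S'\<subseteq>rcosets N'. cyl N S = cyl N' S' \<and> r = card S' / card (rcosets N')"
  then obtain N' S' where "N' \<in> \<N>" "S' \<subseteq> rcosets N'" "cyl N S = cyl N' S'" "r = card S' / card (rcosets N')"
    by blast
  then show "r = card S / card (rcosets N)" using cyl_density_unique assms by metis
qed

text \<open>Induction on the number of sets, intersecting the level found so far with that of the
  next set.\<close>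

lemma cyl_algebra_common:
  assumes "\<forall>i<n::nat. A i \<in> cyl_algebra"
  obtains N S where "N \<in> \<N>" "\<forall>i<n. S i \<subseteq> rcosets N \<and> A i = cyl N (S i)"
proof -
  have "\<exists>N\<in>\<N>. \<forall>i<n. \<exists>S\<subseteq>rcosets N. A i = cyl N S"
    using assms
  proof (induction n)
    case 0
    then show ?case using nonempty by auto
  next
    case (Suc n)
    have "\<forall>i<n. A i \<in> cyl_algebra" using Suc.prems less_SucI by blast
    from Suc.IH[OF this] obtain N where N: "N \<in> \<N>" "\<forall>i<n. \<exists>S\<subseteq>rcosets N. A i = cyl N S" ..
    have "A n \<in> cyl_algebra" using Suc.prems by blast
    then obtain K T where K: "K \<in> \<N>" "T \<subseteq> rcosets K" "A n = cyl K T"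
      unfolding cyl_algebra_def by blast
    let ?L = "N \<inter> K"
    have L: "?L \<in> \<N>" using Int_closed[OF N(1) K(1)] .
    have "\<exists>S\<subseteq>rcosets ?L. A i = cyl ?L S" if "i < Suc n" for i
    proof (cases "i = n")
      case True
      then have "A i = cyl ?L {c \<in> rcosets ?L. K <#> c \<in> T}"
        using cyl_refine[OF K(1) L, of T] K(3) by simp
      then show ?thesis by (intro exI[of _ "{c \<in> rcosets ?L. K <#> c \<in> T}"]) simp
    next
      case False
      then have "i < n" using \<open>i < Suc n\<close> by simp
      then obtain S where "A i = cyl N S" using N(2) by blast
      then have "A i = cyl ?L {c \<in> rcosets ?L. N <#> c \<in> S}"
        using cyl_refine[OF N(1) L, of S] by simp
      then show ?thesis by (intro exI[of _ "{c \<in> rcosets ?L. N <#> c \<in> S}"]) simp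
    qed
    then show ?case by (intro bexI[OF _ L]) simp
  qed
  then obtain N where N: "N \<in> \<N>" "\<forall>i<n. \<exists>S\<subseteq>rcosets N. A i = cyl N S" ..
  then have "\<forall>i. \<exists>S. i < n \<longrightarrow> S \<subseteq> rcosets N \<and> A i = cyl N S" by simp
  from choice[OF this] obtain S where "\<forall>i. i < n \<longrightarrow> S i \<subseteq> rcosets N \<and> A i = cyl N (S i)" ..
  then show ?thesis by (intro that[OF N(1), of S] allI impI) simp
qed

lemma cyl_algebra_common2:
  assumes "A \<in> cyl_algebra" "B \<in> cyl_algebra"
  obtains N S T where "N \<in> \<N>" "S \<subseteq> rcosets N" "T \<subseteq> rcosets N" "A = cyl N S" "B = cyl N T"
proof -
  have "\<forall>i<2::nat. (if i = 0 then A else B) \<in> cyl_algebra" using assms by simp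
  then obtain N S where "N \<in> \<N>" "\<forall>i<2::nat. S i \<subseteq> rcosets N \<and> (if i = 0 then A else B) = cyl N (S i)"
    by (rule cyl_algebra_common)
  from this(1) this(2)[rule_format, of 0] this(2)[rule_format, of 1] show ?thesis
    by (intro that[of N "S 0" "S 1"]) auto
qed

lemma cyl_in_algebra: "N \<in> \<N> \<Longrightarrow> S \<subseteq> rcosets N \<Longrightarrow> cyl N S \<in> cyl_algebra"
  by (auto simp: cyl_algebra_def)

lemma cyl_Diff: "N \<in> \<N> \<Longrightarrow> completion G \<N> - cyl N S = cyl N (rcosets N - S)"
  using completion_rcosets by (auto simp: cyl_def)

lemma algebra_cyl: "algebra (completion G \<N>) cyl_algebra"
  unfolding algebra_iff_Un
proof (intro conjI ballI)
  show "cyl_algebra \<subseteq> Pow (completion G \<N>)" by (auto simp: cyl_algebra_def cyl_def)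
  obtain N where "N \<in> \<N>" using nonempty by auto
  then have "cyl N {} \<in> cyl_algebra" by (auto intro: cyl_in_algebra)
  then show "{} \<in> cyl_algebra" by (simp add: cyl_def)
next
  fix A assume "A \<in> cyl_algebra"
  then show "completion G \<N> - A \<in> cyl_algebra"
    using cyl_Diff unfolding cyl_algebra_def by (smt (verit) Diff_subset mem_Collect_eq)
next
  fix A B assume "A \<in> cyl_algebra" "B \<in> cyl_algebra"
  then obtain N S T where "N \<in> \<N>" "S \<subseteq> rcosets N" "T \<subseteq> rcosets N" "A = cyl N S" "B = cyl N T"
    by (rule cyl_algebra_common2)
  moreover have "cyl N S \<union> cyl N T = cyl N (S \<union> T)" by (auto simp: cyl_def)
  ultimately show "A \<union> B \<in> cyl_algebra" by (auto intro!: cyl_in_algebra)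
qed

text \<open>By finite index, a cylinder over a set of cosets is a finite union of basic
  cylinders.\<close>

lemma sigma_sets_cyl_algebra:
  "sigma_sets (completion G \<N>) (cylinders G \<N>) = sigma_sets (completion G \<N>) cyl_algebra"
proof (rule sigma_sets_eqI)
  fix A assume "A \<in> cylinders G \<N>"
  then obtain N c where "N \<in> \<N>" "c \<in> rcosets N" "A = cyl N {c}"
    by (auto simp: cylinders_def cyl_def)
  then show "A \<in> sigma_sets (completion G \<N>) cyl_algebra"
    by (auto intro!: sigma_sets.Basic cyl_in_algebra)
next
  fix A assume "A \<in> cyl_algebra"
  then obtain N S where N: "N \<in> \<N>" "S \<subseteq> rcosets N" "A = cyl N S" by (auto simp: cyl_algebra_def)
  interpret s: sigma_algebra "completion G \<N>" "sigma_sets (completion G \<N>) (cylinders G \<N>)"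
    by (rule sigma_algebra_sigma_sets) (auto simp: cylinders_def)
  have "A = (\<Union>c\<in>S. {x \<in> completion G \<N>. x N = c})" using N by (auto simp: cyl_def)
  moreover have "finite S" using N finite_index finite_subset by blast
  then have "(\<Union>c\<in>S. {x \<in> completion G \<N>. x N = c}) \<in> sigma_sets (completion G \<N>) (cylinders G \<N>)"
    by (rule s.finite_UN) (use N in \<open>auto intro!: sigma_sets.Basic simp: cylinders_def\<close>)
  ultimately show "A \<in> sigma_sets (completion G \<N>) (cylinders G \<N>)" by simp
qed

section \<open>Compactness and the existence of Haar measure\<close>

definition prodtop :: "('a set \<Rightarrow> 'a set) topology" where
  "prodtop = product_topology (\<lambda>N. discrete_topology (rcosets N)) \<N>"

lemma topspace_prodtop: "topspace prodtop = (\<Pi>\<^sub>E N\<in>\<N>. rcosets N)"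
  by (simp add: prodtop_def)

lemma compact_prodtop: "compact_space prodtop"
  unfolding prodtop_def
  by (simp add: compact_space_product_topology compact_space_discrete_topology finite_index)

lemma closedin_coord:
  assumes "N \<in> \<N>"
  shows "closedin prodtop {x \<in> topspace prodtop. x N \<in> S}"
proof -
  have "closedin prodtop {x \<in> topspace prodtop. x N \<in> S \<inter> rcosets N}"
    by (rule closedin_continuous_map_preimage[where Y = "discrete_topology (rcosets N)"])
       (use assms in \<open>auto simp: prodtop_def intro: continuous_map_product_projection\<close>)
  moreover have "{x \<in> topspace prodtop. x N \<in> S \<inter> rcosets N} = {x \<in> topspace prodtop. x N \<in> S}"
    using assms by (auto simp: topspace_prodtop)
  ultimately show ?thesis by simp
qed

lemma closedin_completion: "closedin prodtop (completion G \<N>)"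
proof -
  \<comment> \<open>The condition \<open>x N \<subseteq> x M\<close> is split over the finitely many
    values \<open>c\<close> of \<open>x N\<close>. Each case constrains two single coordinates, so
    the condition is closed.\<close>
  let ?C = "\<lambda>N M. (\<Union>c\<in>rcosets N. {x \<in> topspace prodtop. x N \<in> {c}} \<inter> {x \<in> topspace prodtop. x M \<in> {d. c \<subseteq> d}})"
  let ?P = "{(N, M). N \<in> \<N> \<and> M \<in> \<N> \<and> N \<subseteq> M}"
  have cl: "closedin prodtop (?C N M)" if "N \<in> \<N>" "M \<in> \<N>" for N M
  proof (intro closedin_Union finite_imageI finite_index that)
    fix T assume "T \<in> (\<lambda>c. {x \<in> topspace prodtop. x N \<in> {c}} \<inter> {x \<in> topspace prodtop. x M \<in> {d. c \<subseteq> d}}) ` (rcosets N)"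
    then obtain c where "T = {x \<in> topspace prodtop. x N \<in> {c}} \<inter> {x \<in> topspace prodtop. x M \<in> {d. c \<subseteq> d}}"
      by blast
    then show "closedin prodtop T" by (simp only:) (intro closedin_Int closedin_coord that)
  qed
  have "completion G \<N> = \<Inter>((\<lambda>(N, M). ?C N M) ` ?P)"
  proof (intro equalityI subsetI)
    fix x assume "x \<in> completion G \<N>"
    note x0 = this[unfolded completion_iff]
    have x1: "x \<in> topspace prodtop"
      unfolding topspace_prodtop by (rule conjunct1[OF x0])
    have x2: "x N \<subseteq> x M" if "N \<in> \<N>" "M \<in> \<N>" "N \<subseteq> M" for N M
      by (rule conjunct2[OF x0, rule_format, OF that])
    have "x \<in> ?C N M" if "N \<in> \<N>" "M \<in> \<N>" "N \<subseteq> M" for N M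
    proof (rule UN_I)
      show "x N \<in> rcosets N" using x1 that(1) unfolding topspace_prodtop by (rule PiE_mem)
      show "x \<in> {y \<in> topspace prodtop. y N \<in> {x N}} \<inter> {y \<in> topspace prodtop. y M \<in> {d. x N \<subseteq> d}}"
        using x1 x2[OF that] by blast
    qed
    then show "x \<in> \<Inter>((\<lambda>(N, M). ?C N M) ` ?P)" by blast
  next
    fix x assume x: "x \<in> \<Inter>((\<lambda>(N, M). ?C N M) ` ?P)"
    obtain N where "N \<in> \<N>" using nonempty by auto
    \<comment> \<open>Any diagonal pair already forces \<open>x\<close> into the product
      space.\<close>
    then have "x \<in> ?C N N" using x by blast
    then have "x \<in> topspace prodtop" by blast
    moreover have "x N \<subseteq> x M" if "N \<in> \<N>" "M \<in> \<N>" "N \<subseteq> M" for N M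
    proof -
      have "x \<in> ?C N M" using x that by blast
      then show ?thesis by blast
    qed
    ultimately show "x \<in> completion G \<N>"
      unfolding completion_iff topspace_prodtop by (intro conjI ballI impI)
  qed
  moreover have "closedin prodtop (\<Inter>((\<lambda>(N, M). ?C N M) ` ?P))"
    by (rule closedin_Inter) (use nonempty cl in auto)
  ultimately show ?thesis by simp
qed

lemma closedin_cyl:
  assumes "A \<in> cyl_algebra" shows "closedin prodtop A"
proof -
  obtain N S where N: "N \<in> \<N>" "A = cyl N S" using assms by (auto simp: cyl_algebra_def)
  have "A = completion G \<N> \<inter> {x \<in> topspace prodtop. x N \<in> S}"
    using N closedin_subset[OF closedin_completion] by (auto simp: cyl_def)
  then show ?thesis using closedin_completion closedin_coord N by auto
qed

text \<open>Continuity at the empty set comes from compactness: a decreasing sequence of nonempty members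
  of the cylinder algebra has nonempty intersection by Tychonoff's theorem.\<close>

lemma ex_haar: "\<exists>M. is_haar G \<N> M"
proof -
  interpret alg: algebra "completion G \<N>" cyl_algebra by (rule algebra_cyl)
  have "\<exists>\<mu>. (\<forall>s\<in>cyl_algebra. \<mu> s = ennreal (density s)) \<and>
      measure_space (completion G \<N>) (sigma_sets (completion G \<N>) cyl_algebra) \<mu>"
  proof (rule alg.caratheodory_empty_continuous)
    obtain N where N: "N \<in> \<N>" using nonempty by auto
    have "density {} = 0" using density_cyl[OF N, of "{}"] by (simp add: cyl_def)
    then show "positive cyl_algebra (\<lambda>s. ennreal (density s))" by (simp add: positive_def)
  next
    show "additive cyl_algebra (\<lambda>s. ennreal (density s))"
    unfolding additive_def
    proof (intro ballI impI)
      fix A B assume AB: "A \<in> cyl_algebra" "B \<in> cyl_algebra" "A \<inter> B = {}"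
      then obtain N S T where N: "N \<in> \<N>" "S \<subseteq> rcosets N" "T \<subseteq> rcosets N" "A = cyl N S" "B = cyl N T"
        using cyl_algebra_common2 by metis
      have "S \<inter> T = {}"
        by (rule cyl_inj[OF N(1)]) (use N AB in \<open>auto simp: cyl_def\<close>)
      moreover have "A \<union> B = cyl N (S \<union> T)" using N by (auto simp: cyl_def)
      moreover have "finite S" "finite T" using N finite_index finite_subset by blast+
      ultimately have "density (A \<union> B) = density A + density B"
        using N by (simp add: density_cyl card_Un_disjoint add_divide_distrib)
      then show "ennreal (density (A \<union> B)) = ennreal (density A) + ennreal (density B)"
        using N by (simp add: density_cyl)
    qed
  next
    fix A :: "nat \<Rightarrow> _" assume A: "range A \<subseteq> cyl_algebra" "decseq A" "(\<Inter>i. A i) = {}"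
    have "\<exists>n. A n = {}"
      using compact_space_imp_nest[OF compact_prodtop, of A] closedin_cyl A by blast
    then obtain n where "A n = {}" by auto
    then have "A m = {}" if "m \<ge> n" for m using A(2) that by (auto simp: decseq_def)
    moreover obtain N where N: "N \<in> \<N>" using nonempty by auto
    have "density {} = 0" using density_cyl[OF N, of "{}"] by (simp add: cyl_def)
    ultimately have "eventually (\<lambda>i. ennreal (density (A i)) = 0) sequentially"
      by (auto simp: eventually_sequentially intro!: exI[of _ n])
    then show "(\<lambda>i. ennreal (density (A i))) \<longlonglongrightarrow> 0"
      by (rule tendsto_eventually)
  qed auto
  then obtain \<mu> where \<mu>: "\<And>s. s \<in> cyl_algebra \<Longrightarrow> \<mu> s = ennreal (density s)"
    and ms: "measure_space (completion G \<N>) (sigma_sets (completion G \<N>) cyl_algebra) \<mu>"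
    by blast
  define M where "M = measure_of (completion G \<N>) (sigma_sets (completion G \<N>) cyl_algebra) \<mu>"
  have sp: "space M = completion G \<N>" by (simp add: M_def space_measure_of_conv)
  have sub: "cyl_algebra \<subseteq> Pow (completion G \<N>)" by (auto simp: cyl_algebra_def cyl_def)
  have se: "sets M = sigma_sets (completion G \<N>) cyl_algebra"
    unfolding M_def using sigma_sets_into_sp[OF sub]
    by (subst sets_measure_of) (auto simp: sigma_sets_sigma_sets_eq[OF sub])
  have em: "emeasure M A = \<mu> A" if "A \<in> sets M" for A
    unfolding M_def
    by (rule emeasure_measure_of_sigma)
       (use ms that in \<open>auto simp: measure_space_def se\<close>)
  have meas: "emeasure M (cyl N S) = ennreal (card S / card (rcosets N))" if "N \<in> \<N>" "S \<subseteq> rcosets N" for N S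
    using that em[of "cyl N S"] \<mu>[of "cyl N S"] cyl_in_algebra[OF that] density_cyl[OF that] se by auto
  obtain N where N: "N \<in> \<N>" using nonempty by auto
  have "cyl N (rcosets N) = space M" using completion_rcosets N by (auto simp: cyl_def sp)
  then have "emeasure M (space M) = 1" using meas[OF N order_refl] index_pos[OF N] by simp
  then have "prob_space M" by (rule prob_spaceI)
  moreover have "measure M {x \<in> completion G \<N>. x N = c} = 1 / card (rcosets N)"
    if "N \<in> \<N>" "c \<in> rcosets N" for N c
  proof -
    have "{x \<in> completion G \<N>. x N = c} = cyl N {c}" by (auto simp: cyl_def)
    then show ?thesis using meas[of N "{c}"] that by (simp add: measure_def)
  qed
  ultimately have "is_haar G \<N> M"
    by (simp add: is_haar_def sp se sigma_sets_cyl_algebra)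
  then show ?thesis by blast
qed

lemma is_haar_haar: "is_haar G \<N> (haar G \<N>)"
  unfolding haar_def using ex_haar by (rule someI_ex)

end

section \<open>Weak containment from almost equivariant maps\<close>

lemma abs_card_diff_le:
  assumes "finite X" "finite Y" "X - Y \<subseteq> Z" "Y - X \<subseteq> Z" "finite Z"
  shows "\<bar>real (card X) - real (card Y)\<bar> \<le> real (card Z)"
proof -
  have "card X \<le> card Y + card Z"
    using card_mono[of "Y \<union> Z" X] card_Un_le[of Y Z] assms by (auto intro: order_trans)
  moreover have "card Y \<le> card X + card Z"
    using card_mono[of "X \<union> Z" Y] card_Un_le[of X Z] assms by (auto intro: order_trans)
  ultimately show ?thesis by linarith
qed

text \<open>If any two fibres have almost the same size, each is close to the average fibre, and
  summing over \<open>R\<close> gives almost the uniform measure of \<open>R\<close>.\<close>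

lemma near_uniform_preimage:
  fixes \<eta> :: real
  assumes P: "finite P" "P \<noteq> {}" and Q: "finite Q" "Q \<noteq> {}" and \<phi>: "\<phi> \<in> P \<rightarrow> Q"
    and near: "\<And>d d'. d \<in> Q \<Longrightarrow> d' \<in> Q \<Longrightarrow>
      \<bar>real (card {c \<in> P. \<phi> c = d}) - real (card {c \<in> P. \<phi> c = d'})\<bar> \<le> \<eta> * card P"
    and R: "R \<subseteq> Q"
  shows "\<bar>card {c \<in> P. \<phi> c \<in> R} / card P - card R / card Q\<bar> \<le> card Q * \<eta>"
proof -
  define f where "f d = real (card {c \<in> P. \<phi> c = d})" for d
  have fin: "finite R" using R Q finite_subset by blast
  have count: "real (card {c \<in> P. \<phi> c \<in> T}) = (\<Sum>d\<in>T. f d)" if "T \<subseteq> Q" for T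
  proof -
    have "finite T" using that Q finite_subset by blast
    have "{c \<in> P. \<phi> c \<in> T} = (\<Union>d\<in>T. {c \<in> P. \<phi> c = d})" by blast
    also have "card \<dots> = (\<Sum>d\<in>T. card {c \<in> P. \<phi> c = d})"
      by (rule card_UN_disjoint) (use \<open>finite T\<close> P in auto)
    finally show ?thesis by (simp add: f_def)
  qed
  have all: "real (card P) = (\<Sum>d\<in>Q. f d)"
  proof -
    have "{c \<in> P. \<phi> c \<in> Q} = P" using \<phi> by blast
    then show ?thesis using count[of Q] by simp
  qed
  have "\<eta> * card P \<ge> 0" using near Q(2) by force
  have pos: "real (card P) > 0" "real (card Q) > 0" using P Q by (simp_all add: card_gt_0_iff)
  \<comment> \<open>Clearing denominators turns the discrepancy into a double sum of differences of
    fibre sizes, each controlled by \<open>near\<close>.\<close>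
  have "\<bar>(\<Sum>d\<in>R. f d) * card Q - card R * (\<Sum>d\<in>Q. f d)\<bar> = \<bar>\<Sum>d\<in>R. \<Sum>d'\<in>Q. (f d - f d')\<bar>"
    by (simp add: sum_subtractf sum_distrib_left sum_distrib_right mult.commute)
  also have "\<dots> \<le> (\<Sum>d\<in>R. \<bar>\<Sum>d'\<in>Q. (f d - f d')\<bar>)" by (rule sum_abs)
  also have "\<dots> \<le> (\<Sum>d\<in>R. \<Sum>d'\<in>Q. \<bar>f d - f d'\<bar>)" by (intro sum_mono sum_abs)
  also have "\<dots> \<le> (\<Sum>d\<in>R. \<Sum>d'\<in>Q. \<eta> * card P)"
    unfolding f_def by (intro sum_mono near) (use R in blast)+
  also have "\<dots> = card R * (card Q * (\<eta> * card P))" by simp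
  also have "\<dots> \<le> card Q * (card Q * (\<eta> * card P))"
    by (rule mult_right_mono) (use R Q \<open>\<eta> * card P \<ge> 0\<close> in \<open>auto intro!: card_mono mult_nonneg_nonneg\<close>)
  finally have le: "\<bar>(\<Sum>d\<in>R. f d) * card Q - card R * real (card P)\<bar> \<le> card Q * (card Q * (\<eta> * card P))"
    using all by simp
  have "card {c \<in> P. \<phi> c \<in> R} / card P - card R / card Q = ((\<Sum>d\<in>R. f d) * card Q - card R * real (card P)) / (card P * card Q)"
    using pos count[OF R] by (simp add: field_simps)
  then have "\<bar>card {c \<in> P. \<phi> c \<in> R} / card P - card R / card Q\<bar> = \<bar>(\<Sum>d\<in>R. f d) * card Q - card R * real (card P)\<bar> / (card P * card Q)"
    by simp
  also have "\<dots> \<le> (card Q * (card Q * (\<eta> * card P))) / (card P * card Q)"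
    by (rule divide_right_mono[OF le]) simp
  also have "\<dots> = card Q * \<eta>" using pos by (simp add: field_simps)
  finally show ?thesis .
qed

section \<open>Measures of symmetric differences\<close>

context finite_measure
begin

lemma measure_symdiff_triangle:
  assumes "A \<in> sets M" "B \<in> sets M" "C \<in> sets M"
  shows "measure M (A - C \<union> (C - A)) \<le> measure M (A - B \<union> (B - A)) + measure M (B - C \<union> (C - B))"
proof -
  have "measure M (A - C \<union> (C - A)) \<le> measure M ((A - B \<union> (B - A)) \<union> (B - C \<union> (C - B)))"
    by (rule finite_measure_mono) (use assms in auto)
  also have "\<dots> \<le> measure M (A - B \<union> (B - A)) + measure M (B - C \<union> (C - B))"
    by (rule measure_Un_le) (use assms in auto)
  finally show ?thesis .
qed

lemma measure_symdiff_Un: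
  assumes "A \<in> sets M" "B \<in> sets M" "A' \<in> sets M" "B' \<in> sets M"
  shows "measure M ((A \<union> B) - (A' \<union> B') \<union> ((A' \<union> B') - (A \<union> B)))
    \<le> measure M (A - A' \<union> (A' - A)) + measure M (B - B' \<union> (B' - B))"
proof -
  have "measure M ((A \<union> B) - (A' \<union> B') \<union> ((A' \<union> B') - (A \<union> B))) \<le> measure M ((A - A' \<union> (A' - A)) \<union> (B - B' \<union> (B' - B)))"
    by (rule finite_measure_mono) (use assms in auto)
  also have "\<dots> \<le> measure M (A - A' \<union> (A' - A)) + measure M (B - B' \<union> (B' - B))"
    by (rule measure_Un_le) (use assms in auto)
  finally show ?thesis .
qed

lemma measure_Int_symdiff:
  assumes "A \<in> sets M" "B \<in> sets M" "A' \<in> sets M" "B' \<in> sets M"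
  shows "\<bar>measure M (A \<inter> B) - measure M (A' \<inter> B')\<bar>
    \<le> measure M (A - A' \<union> (A' - A)) + measure M (B - B' \<union> (B' - B))"
proof -
  have le: "measure M (X \<inter> Y) \<le> measure M (X' \<inter> Y') + (measure M (X - X' \<union> (X' - X)) + measure M (Y - Y' \<union> (Y' - Y)))"
    if "X \<in> sets M" "Y \<in> sets M" "X' \<in> sets M" "Y' \<in> sets M" for X Y X' Y'
  proof -
    have "measure M (X \<inter> Y) \<le> measure M ((X' \<inter> Y') \<union> ((X - X' \<union> (X' - X)) \<union> (Y - Y' \<union> (Y' - Y))))"
      by (rule finite_measure_mono) (use that in auto)
    also have "\<dots> \<le> measure M (X' \<inter> Y') + measure M ((X - X' \<union> (X' - X)) \<union> (Y - Y' \<union> (Y' - Y)))"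
      by (rule measure_Un_le) (use that in auto)
    also have "measure M ((X - X' \<union> (X' - X)) \<union> (Y - Y' \<union> (Y' - Y))) \<le> measure M (X - X' \<union> (X' - X)) + measure M (Y - Y' \<union> (Y' - Y))"
      by (rule measure_Un_le) (use that in auto)
    finally show ?thesis by simp
  qed
  have "A' - A \<union> (A - A') = A - A' \<union> (A' - A)" "B' - B \<union> (B - B') = B - B' \<union> (B' - B)" by auto
  then show ?thesis using le[OF assms] le[OF assms(3,4,1,2)] by simp
qed

end

section \<open>Translations of cosets and of completions\<close>

context group
begin

lemma l_coset_closed:
  assumes "N \<lhd> G" "g \<in> carrier G" "c \<in> rcosets N"
  shows "g <# c \<in> rcosets N"
proof -
  obtain h where "h \<in> carrier G" "c = N #> h" using rcosets_obtain[OF assms(3)] .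
  then show ?thesis
    using l_coset_rcoset[OF assms(1,2)] rcosetsI[OF normal_imp_subgroup[THEN subgroup.subset, OF assms(1)]] assms(2) by simp
qed

lemma rcosets_sub_carrier: "N \<lhd> G \<Longrightarrow> c \<in> rcosets N \<Longrightarrow> c \<subseteq> carrier G"
  using normal_imp_subgroup subgroup.rcosets_carrier is_group by blast

lemma l_coset_mult:
  assumes "N \<lhd> G" "c \<in> rcosets N" "g \<in> carrier G" "h \<in> carrier G"
  shows "g <# (h <# c) = (g \<otimes> h) <# c"
  using lcos_m_assoc[OF rcosets_sub_carrier[OF assms(1,2)] assms(3,4)] .

lemma l_coset_one: "N \<lhd> G \<Longrightarrow> c \<in> rcosets N \<Longrightarrow> \<one> <# c = c"
  using lcos_mult_one rcosets_sub_carrier by blast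

lemma l_coset_inv:
  assumes "N \<lhd> G" "c \<in> rcosets N" "g \<in> carrier G"
  shows "inv g <# (g <# c) = c" "g <# (inv g <# c) = c"
  using l_coset_mult[OF assms(1,2)] l_coset_one[OF assms(1,2)] assms(3) by simp_all

lemma l_coset_bij:
  assumes "N \<lhd> G" "g \<in> carrier G"
  shows "bij_betw (\<lambda>c. g <# c) (rcosets N) (rcosets N)"
  by (rule bij_betw_byWitness[where f' = "\<lambda>c. inv g <# c"])
     (use assms l_coset_inv[OF assms(1)] l_coset_closed[OF assms(1)] in auto)

end

context profinite_family
begin

lemma comp_act_apply: "N \<in> \<N> \<Longrightarrow> comp_act G \<N> g x N = g <# x N"
  by (simp add: comp_act_def)

lemma comp_act_closed:
  assumes "g \<in> carrier G" "x \<in> completion G \<N>"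
  shows "comp_act G \<N> g x \<in> completion G \<N>"
  unfolding completion_iff
proof (intro conjI PiE_I ballI impI)
  fix N assume N: "N \<in> \<N>"
  then show "comp_act G \<N> g x N \<in> rcosets N"
    using l_coset_closed[OF normal assms(1)] completion_rcosets[OF assms(2)] by (simp add: comp_act_apply)
next
  fix N M assume NM: "N \<in> \<N>" "M \<in> \<N>" "N \<subseteq> M"
  then have "x N \<subseteq> x M" using assms(2) unfolding completion_def by blast
  then show "comp_act G \<N> g x N \<subseteq> comp_act G \<N> g x M"
    using NM by (auto simp: comp_act_apply l_coset_def)
qed (simp add: comp_act_def)

lemma completion_eqI:
  assumes "x \<in> completion G \<N>" "y \<in> completion G \<N>" "\<And>N. N \<in> \<N> \<Longrightarrow> x N = y N"
  shows "x = y"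
proof (rule PiE_ext)
  show "x \<in> \<N> \<rightarrow>\<^sub>E UNIV" "y \<in> \<N> \<rightarrow>\<^sub>E UNIV" using assms by (simp_all add: completion_def)
qed (rule assms(3))

lemma comp_act_inv:
  assumes "g \<in> carrier G" "x \<in> completion G \<N>"
  shows "comp_act G \<N> (inv g) (comp_act G \<N> g x) = x" "comp_act G \<N> g (comp_act G \<N> (inv g) x) = x"
  by (rule completion_eqI,
      simp_all add: comp_act_closed assms comp_act_apply l_coset_inv[OF normal completion_rcosets])+

lemma comp_act_bij:
  assumes "g \<in> carrier G"
  shows "bij_betw (comp_act G \<N> g) (completion G \<N>) (completion G \<N>)"
  by (rule bij_betw_byWitness[where f' = "comp_act G \<N> (inv g)"])
     (use assms comp_act_inv comp_act_closed in auto)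

lemma comp_act_cyl:
  assumes "g \<in> carrier G" "N \<in> \<N>" "S \<subseteq> rcosets N"
  shows "comp_act G \<N> g ` cyl N S = cyl N ((\<lambda>c. g <# c) ` S)"
proof (intro equalityI subsetI)
  fix y assume "y \<in> comp_act G \<N> g ` cyl N S"
  then show "y \<in> cyl N ((\<lambda>c. g <# c) ` S)"
    using assms comp_act_closed by (auto simp: cyl_def comp_act_apply)
next
  fix y assume "y \<in> cyl N ((\<lambda>c. g <# c) ` S)"
  then obtain c where c: "y \<in> completion G \<N>" "c \<in> S" "y N = g <# c" by (auto simp: cyl_def)
  have "comp_act G \<N> (inv g) y \<in> cyl N S"
    using c assms comp_act_closed l_coset_inv[OF normal, of N c g] by (auto simp: cyl_def comp_act_apply)
  then show "y \<in> comp_act G \<N> g ` cyl N S"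
    using comp_act_inv(2)[OF assms(1) c(1)] by (metis imageI)
qed

lemma Int_stable_cyl_algebra: "Int_stable cyl_algebra"
  using algebra.axioms(1)[OF algebra_cyl] ring_of_sets.axioms(1) semiring_of_sets.Int
  by (intro Int_stableI) blast

lemma cyl_algebra_Pow: "cyl_algebra \<subseteq> Pow (completion G \<N>)"
  by (auto simp: cyl_algebra_def cyl_def)

end

section \<open>Invariance of Haar measure and approximation by cylinders\<close>

locale haar_family = profinite_family +
  fixes M :: "('a set \<Rightarrow> 'a set) measure"
  assumes haar: "is_haar G \<N> M"
begin

sublocale prob_space M using haar by (simp add: is_haar_def)

lemma space_M: "space M = completion G \<N>" using haar by (simp add: is_haar_def)

lemma sets_M: "sets M = sigma_sets (completion G \<N>) cyl_algebra"
  using haar by (simp add: is_haar_def sigma_sets_cyl_algebra)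

lemma cyl_algebra_sets: "A \<in> cyl_algebra \<Longrightarrow> A \<in> sets M"
  by (simp add: sets_M sigma_sets.Basic)

lemma cyl_sets: "N \<in> \<N> \<Longrightarrow> S \<subseteq> rcosets N \<Longrightarrow> cyl N S \<in> sets M"
  by (simp add: cyl_algebra_sets cyl_in_algebra)

lemma measure_cyl:
  assumes "N \<in> \<N>" "S \<subseteq> rcosets N"
  shows "measure M (cyl N S) = card S / card (rcosets N)"
proof -
  have "finite S" using assms finite_index finite_subset by blast
  have "cyl N S = (\<Union>c\<in>S. cyl N {c})" by (auto simp: cyl_def)
  also have "measure M \<dots> = (\<Sum>c\<in>S. measure M (cyl N {c}))"
    by (rule finite_measure_finite_Union)
       (use assms \<open>finite S\<close> in \<open>auto simp: disjoint_family_on_def cyl_def intro!: cyl_sets[unfolded cyl_def, of N "{c}" for c, simplified]\<close>)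
  also have "\<dots> = (\<Sum>c\<in>S. 1 / card (rcosets N))"
    by (rule sum.cong) (use haar assms in \<open>auto simp: is_haar_def cyl_def\<close>)
  finally show ?thesis by simp
qed

text \<open>A Dynkin argument on the intersection-stable generator \<open>cyl_algebra\<close>. On a
  cylinder, translation only permutes the cosets at its level; complements and disjoint unions pass
  through because translation is a bijection. Measurability and measure are proved together, since
  the complement case uses both.\<close>

lemma invariant:
  assumes g: "g \<in> carrier G" and A: "A \<in> sets M"
  shows "comp_act G \<N> g ` A \<in> sets M \<and> measure M (comp_act G \<N> g ` A) = measure M A"
proof -
  let ?f = "comp_act G \<N> g"
  have bij: "bij_betw ?f (completion G \<N>) (completion G \<N>)" by (rule comp_act_bij[OF g])
  have inj: "inj_on ?f (completion G \<N>)" using bij by (rule bij_betw_imp_inj_on)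
  show ?thesis
    using Int_stable_cyl_algebra cyl_algebra_Pow A[unfolded sets_M]
  proof (induction rule: sigma_sets_induct_disjoint)
    case (basic A)
    then obtain N S where N: "N \<in> \<N>" "S \<subseteq> rcosets N" "A = cyl N S" by (auto simp: cyl_algebra_def)
    have sub: "(\<lambda>c. g <# c) ` S \<subseteq> rcosets N" using l_coset_closed[OF normal[OF N(1)] g] N(2) by blast
    have "inj_on (\<lambda>c. g <# c) S"
      using l_coset_bij[OF normal[OF N(1)] g] N(2) bij_betw_imp_inj_on inj_on_subset by blast
    then show ?case
      using N sub by (simp add: comp_act_cyl[OF g] cyl_sets measure_cyl card_image)
  next
    case empty
    then show ?case by simp
  next
    case (compl A)
    then have A: "A \<in> sets M" by (simp add: sets_M)
    then have sub: "A \<subseteq> completion G \<N>" using sets.sets_into_space space_M by blast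
    have eq: "?f ` (completion G \<N> - A) = completion G \<N> - ?f ` A"
      using inj_on_image_set_diff[OF inj _ sub] bij_betw_imp_surj_on[OF bij] by simp
    show ?case
      unfolding eq using compl A finite_measure_compl[of A] finite_measure_compl[of "?f ` A"]
      by (auto simp: space_M[symmetric])
  next
    case (union A)
    have A: "A i \<in> sets M" for i using union by (auto simp: sets_M)
    then have sub: "A i \<subseteq> completion G \<N>" for i using sets.sets_into_space space_M by blast
    have dis: "disjoint_family (\<lambda>i. ?f ` A i)"
      unfolding disjoint_family_on_def
    proof (intro ballI impI)
      fix m n :: nat assume "m \<noteq> n"
      then have "A m \<inter> A n = {}" using union(1) by (auto simp: disjoint_family_on_def)
      then show "?f ` A m \<inter> ?f ` A n = {}"
        using inj_on_image_Int[OF inj sub sub, of m n] by simp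
    qed
    have "(\<lambda>i. measure M (A i)) sums measure M (\<Union>i. A i)"
      using finite_measure_UNION[of A] A union(1) by blast
    moreover have "(\<lambda>i. measure M (?f ` A i)) sums measure M (\<Union>i. ?f ` A i)"
      using finite_measure_UNION[of "\<lambda>i. ?f ` A i"] union.IH dis by blast
    moreover have "(\<lambda>i. measure M (?f ` A i)) = (\<lambda>i. measure M (A i))" using union.IH by simp
    ultimately have "measure M (\<Union>i. ?f ` A i) = measure M (\<Union>i. A i)" using sums_unique2 by metis
    then show ?case using union.IH by (auto simp: image_UN)
  qed
qed

text \<open>The approximable sets form a sigma-algebra. Complementation preserves symmetric
  differences, and a countable union is first cut off at a finite one by continuity of the measure
  and then approximated term by term, each of the two errors being below half of the
  tolerance.\<close>

lemma approx_by_cyl: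
  assumes "A \<in> sets M" "\<epsilon> > 0"
  shows "\<exists>B\<in>cyl_algebra. measure M (A - B \<union> (B - A)) < \<epsilon>"
proof -
  interpret alg: algebra "completion G \<N>" cyl_algebra by (rule algebra_cyl)
  have "\<forall>\<epsilon>>0. \<exists>B\<in>cyl_algebra. measure M (A - B \<union> (B - A)) < \<epsilon>"
    using assms(1)[unfolded sets_M]
  proof (induction rule: sigma_sets.induct)
    case (Basic A)
    then show ?case by (intro allI impI bexI[of _ A]) auto
  next
    case Empty
    then show ?case by (intro allI impI bexI[of _ "{}"]) auto
  next
    case (Compl A)
    show ?case
    proof (intro allI impI)
      fix \<epsilon> :: real assume "\<epsilon> > 0"
      then obtain B where B: "B \<in> cyl_algebra" "measure M (A - B \<union> (B - A)) < \<epsilon>" using Compl by blast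
      have "A \<subseteq> completion G \<N>" using Compl(1) sigma_sets_into_sp[OF cyl_algebra_Pow] by blast
      then have "(completion G \<N> - A) - (completion G \<N> - B) \<union> ((completion G \<N> - B) - (completion G \<N> - A)) = A - B \<union> (B - A)"
        using B(1) cyl_algebra_Pow by blast
      then show "\<exists>B\<in>cyl_algebra. measure M ((completion G \<N> - A) - B \<union> (B - (completion G \<N> - A))) < \<epsilon>"
        using B by (intro bexI[of _ "completion G \<N> - B"]) auto
    qed
  next
    case (Union A)
    have A: "A i \<in> sets M" for i using Union(1) by (simp add: sets_M)
    have fin: "\<forall>\<epsilon>>0. \<exists>B\<in>cyl_algebra. measure M ((\<Union>i<n. A i) - B \<union> (B - (\<Union>i<n. A i))) < \<epsilon>" for n
    proof (induction n)
      case 0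
      then show ?case by (intro allI impI bexI[of _ "{}"]) auto
    next
      case (Suc n)
      show ?case
      proof (intro allI impI)
        fix \<epsilon> :: real assume "\<epsilon> > 0"
        then have e: "\<epsilon> / 2 > 0" by simp
        obtain B where B: "B \<in> cyl_algebra" "measure M ((\<Union>i<n. A i) - B \<union> (B - (\<Union>i<n. A i))) < \<epsilon> / 2"
          using Suc e by blast
        obtain C where C: "C \<in> cyl_algebra" "measure M (A n - C \<union> (C - A n)) < \<epsilon> / 2"
          using Union.IH e by blast
        have un: "(\<Union>i<Suc n. A i) = (\<Union>i<n. A i) \<union> A n" by (auto simp: lessThan_Suc)
        have "measure M ((\<Union>i<Suc n. A i) - (B \<union> C) \<union> ((B \<union> C) - (\<Union>i<Suc n. A i))) < \<epsilon>"
          unfolding un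
          using measure_symdiff_Un[of "\<Union>i<n. A i" "A n" B C] A B C cyl_algebra_sets by fastforce
        then show "\<exists>B\<in>cyl_algebra. measure M ((\<Union>i<Suc n. A i) - B \<union> (B - (\<Union>i<Suc n. A i))) < \<epsilon>"
          using B C alg.Un by blast
      qed
    qed
    show ?case
    proof (intro allI impI)
      fix \<epsilon> :: real assume "\<epsilon> > 0"
      then have e: "\<epsilon> / 2 > 0" by simp
      have "(\<lambda>n. measure M (\<Union>i<n. A i)) \<longlonglongrightarrow> measure M (\<Union>n. \<Union>i<n. A i)"
        by (rule finite_Lim_measure_incseq) (use A in \<open>auto simp: incseq_def intro: order_less_le_trans\<close>)
      moreover have "(\<Union>n. \<Union>i<n. A i) = (\<Union>i. A i)" by auto
      ultimately have "(\<lambda>n. measure M (\<Union>i<n. A i)) \<longlonglongrightarrow> measure M (\<Union>i. A i)" by simp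
      from LIMSEQ_D[OF this e] obtain n where n: "\<bar>measure M (\<Union>i<n. A i) - measure M (\<Union>i. A i)\<bar> < \<epsilon> / 2"
        by auto
      have "measure M ((\<Union>i. A i) - (\<Union>i<n. A i)) = measure M (\<Union>i. A i) - measure M (\<Union>i<n. A i)"
        by (rule finite_measure_Diff) (use A in auto)
      moreover have "(\<Union>i. A i) - (\<Union>i<n. A i) \<union> ((\<Union>i<n. A i) - (\<Union>i. A i)) = (\<Union>i. A i) - (\<Union>i<n. A i)" by auto
      ultimately have d1: "measure M ((\<Union>i. A i) - (\<Union>i<n. A i) \<union> ((\<Union>i<n. A i) - (\<Union>i. A i))) < \<epsilon> / 2"
        using n by (simp only: abs_less_iff) linarith
      obtain B where B: "B \<in> cyl_algebra" "measure M ((\<Union>i<n. A i) - B \<union> (B - (\<Union>i<n. A i))) < \<epsilon> / 2"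
        using fin e by blast
      have "measure M ((\<Union>i. A i) - B \<union> (B - (\<Union>i. A i))) < \<epsilon>"
        using measure_symdiff_triangle[of "\<Union>i. A i" "\<Union>i<n. A i" B] A B d1 cyl_algebra_sets by fastforce
      then show "\<exists>B\<in>cyl_algebra. measure M ((\<Union>i. A i) - B \<union> (B - (\<Union>i. A i))) < \<epsilon>"
        using B by blast
    qed
  qed
  then show ?thesis using assms(2) by blast
qed

end

section \<open>Defects of equivariance and the criterion for weak containment\<close>

text \<open>The points of \<open>G/K\<close> at which \<open>\<phi>\<close> fails to intertwine
  translation by \<open>g\<close> with \<open>f\<close>, the intended action of \<open>g\<close> on
  the target.\<close>

definition defect :: "('a, 'b) monoid_scheme \<Rightarrow> 'a set \<Rightarrow> ('a set \<Rightarrow> 'c) \<Rightarrow> ('c \<Rightarrow> 'c) \<Rightarrow> 'a \<Rightarrow> 'a set set" where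
  "defect G K \<phi> f g = {c \<in> rcosets\<^bsub>G\<^esub> K. \<phi> (g <#\<^bsub>G\<^esub> c) \<noteq> f (\<phi> c)}"

text \<open>If \<open>g\<close> moves \<open>d\<close> to \<open>d'\<close>, then off the defect of
  \<open>g\<close> the fibre over \<open>d\<close> is the set of \<open>c\<close> with
  \<open>\<phi> (g <# c) = d'\<close>. That set is as large as the fibre over \<open>d'\<close>, so
  a transitive \<open>T\<close> makes all fibres nearly equal.\<close>

lemma (in group) near_uniform_pushforward:
  fixes \<eta> :: real
  assumes K: "K \<lhd> G" "finite (rcosets K)" and N: "N \<lhd> G" "finite (rcosets N)"
    and \<phi>: "\<phi> \<in> rcosets K \<rightarrow> rcosets N"
    and T: "T \<subseteq> carrier G" "\<And>d d'. d \<in> rcosets N \<Longrightarrow> d' \<in> rcosets N \<Longrightarrow> \<exists>g\<in>T. g <# d = d'"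
    and small: "\<And>g. g \<in> T \<Longrightarrow> card (defect G K \<phi> (\<lambda>d. g <# d) g) \<le> \<eta> * card (rcosets K)"
    and R: "R \<subseteq> rcosets N"
  shows "\<bar>card {c \<in> rcosets K. \<phi> c \<in> R} / card (rcosets K) - card R / card (rcosets N)\<bar>
    \<le> card (rcosets N) * \<eta>"
proof (rule near_uniform_preimage[OF K(2) _ N(2) _ \<phi> _ R])
  show "rcosets K \<noteq> {}" "rcosets N \<noteq> {}"
    using subgroup.subgroup_in_rcosets[OF normal_imp_subgroup is_group] K(1) N(1) by blast+
  fix d d' assume d: "d \<in> rcosets N" "d' \<in> rcosets N"
  obtain g where g: "g \<in> T" "g <# d = d'" using T(2)[OF d] by blast
  then have gG: "g \<in> carrier G" using T by blast
  have "bij_betw (\<lambda>c. g <# c) {c \<in> rcosets K. \<phi> (g <# c) = d'} {c \<in> rcosets K. \<phi> c = d'}"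
    by (rule bij_betw_byWitness[where f' = "\<lambda>c. inv g <# c"])
       (use gG l_coset_inv[OF K(1)] l_coset_closed[OF K(1)] in auto)
  then have "card {c \<in> rcosets K. \<phi> c = d'} = card {c \<in> rcosets K. \<phi> (g <# c) = d'}"
    by (simp add: bij_betw_same_card)
  moreover have "\<bar>real (card {c \<in> rcosets K. \<phi> c = d}) - real (card {c \<in> rcosets K. \<phi> (g <# c) = d'})\<bar>
      \<le> card (defect G K \<phi> (\<lambda>d. g <# d) g)"
  proof (rule abs_card_diff_le)
    show "{c \<in> rcosets K. \<phi> (g <# c) = d'} - {c \<in> rcosets K. \<phi> c = d} \<subseteq> defect G K \<phi> (\<lambda>d. g <# d) g"
    proof
      fix c assume c: "c \<in> {c \<in> rcosets K. \<phi> (g <# c) = d'} - {c \<in> rcosets K. \<phi> c = d}"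
      then have "\<phi> c \<in> rcosets N" "\<phi> c \<noteq> d" using \<phi> by auto
      then have "g <# \<phi> c \<noteq> d'" using l_coset_inv(1)[OF N(1) _ gG] d g(2) by metis
      then show "c \<in> defect G K \<phi> (\<lambda>d. g <# d) g" using c by (auto simp: defect_def)
    qed
  qed (use K(2) g(2) in \<open>auto simp: defect_def\<close>)
  ultimately show "\<bar>real (card {c \<in> rcosets K. \<phi> c = d}) - real (card {c \<in> rcosets K. \<phi> c = d'})\<bar>
      \<le> \<eta> * card (rcosets K)"
    using small[OF g(1)] by simp
qed

lemma (in group) rcosets_transitive:
  assumes "N \<lhd> G" "finite (rcosets N)"
  obtains T where "finite T" "T \<subseteq> carrier G"
    "\<And>d d'. d \<in> rcosets N \<Longrightarrow> d' \<in> rcosets N \<Longrightarrow> \<exists>g\<in>T. g <# d = d'"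
proof -
  have ex: "\<exists>g. g \<in> carrier G \<and> g <# d = d'" if d: "d \<in> rcosets N" "d' \<in> rcosets N" for d d'
  proof -
    obtain h h' where h: "h \<in> carrier G" "d = N #> h" "h' \<in> carrier G" "d' = N #> h'"
      using rcosets_obtain d by metis
    then have "(h' \<otimes> inv h) <# d = d'"
      using l_coset_rcoset[OF assms(1), of "h' \<otimes> inv h" h] by (simp add: m_assoc)
    then show ?thesis using h by blast
  qed
  define t where "t = (\<lambda>(d, d'). SOME g. g \<in> carrier G \<and> g <# d = d')"
  have t: "t (d, d') \<in> carrier G \<and> t (d, d') <# d = d'" if "d \<in> rcosets N" "d' \<in> rcosets N" for d d'
    unfolding t_def prod.case by (rule someI_ex[OF ex[OF that]])
  show ?thesis
  proof (rule that[of "t ` ((rcosets N) \<times> (rcosets N))"])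
    show "finite (t ` ((rcosets N) \<times> (rcosets N)))" using assms by simp
    show "t ` ((rcosets N) \<times> (rcosets N)) \<subseteq> carrier G" using t by blast
  qed (use t in blast)
qed

text \<open>The given sets are replaced by cylinders at one level \<open>N\<close>, and these are
  pulled back along \<open>\<phi>\<close>. A small defect keeps translates of the pulled-back sets
  under control; near uniformity of \<open>\<phi>\<close> keeps their measures.\<close>

lemma (in group) weakly_contains_profinite:
  assumes fam: "profinite_family G \<N>\<^sub>1" "profinite_family G \<N>\<^sub>2"
    and haar: "is_haar G \<N>\<^sub>1 M\<^sub>1" "is_haar G \<N>\<^sub>2 M\<^sub>2"
    and approx: "\<And>N E (\<epsilon>::real). N \<in> \<N>\<^sub>2 \<Longrightarrow> finite E \<Longrightarrow> E \<subseteq> carrier G \<Longrightarrow> 0 < \<epsilon> \<Longrightarrow>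
      \<exists>K\<in>\<N>\<^sub>1. \<exists>\<phi>\<in>rcosets K \<rightarrow> rcosets N.
        \<forall>g\<in>E. card (defect G K \<phi> (\<lambda>d. g <# d) g) \<le> \<epsilon> * card (rcosets K)"
  shows "weakly_contains G (comp_act G \<N>\<^sub>1) M\<^sub>1 (comp_act G \<N>\<^sub>2) M\<^sub>2"
proof -
  interpret F: haar_family G \<N>\<^sub>1 M\<^sub>1
    by (rule haar_family.intro[OF fam(1)]) (simp add: haar_family_axioms_def haar)
  interpret H: haar_family G \<N>\<^sub>2 M\<^sub>2
    by (rule haar_family.intro[OF fam(2)]) (simp add: haar_family_axioms_def haar)
  show ?thesis
    unfolding weakly_contains_def
  proof (intro allI impI, elim conjE)
    fix n :: nat and A :: "nat \<Rightarrow> ('a set \<Rightarrow> 'a set) set" and E and \<epsilon> :: real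
    assume A: "\<forall>i<n. A i \<in> sets M\<^sub>2" and E: "E \<subseteq> carrier G" "finite E" and "\<epsilon> > 0"
    \<comment> \<open>The total error stays below \<open>4 * \<delta>\<close>:
      \<open>2 * \<delta>\<close> for passing to cylinders, and \<open>\<delta>\<close> each for the
      defect and for the pushforward.\<close>
    define \<delta> where "\<delta> = \<epsilon> / 5"
    have \<delta>: "\<delta> > 0" using \<open>\<epsilon> > 0\<close> by (simp add: \<delta>_def)
    have "\<forall>i. \<exists>C. i < n \<longrightarrow> C \<in> H.cyl_algebra \<and> measure M\<^sub>2 (A i - C \<union> (C - A i)) < \<delta>"
      using H.approx_by_cyl A \<delta> by metis
    from choice[OF this] obtain C where
      C: "\<And>i. i < n \<Longrightarrow> C i \<in> H.cyl_algebra" "\<And>i. i < n \<Longrightarrow> measure M\<^sub>2 (A i - C i \<union> (C i - A i)) < \<delta>"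
      by blast
    obtain N S where N: "N \<in> \<N>\<^sub>2" and S: "\<forall>i<n. S i \<subseteq> rcosets N \<and> C i = H.cyl N (S i)"
      using H.cyl_algebra_common[of n C] C(1) by blast
    note nN = H.normal[OF N] and fN = H.finite_index[OF N]
    obtain T where T: "finite T" "T \<subseteq> carrier G"
      "\<And>d d'. d \<in> rcosets N \<Longrightarrow> d' \<in> rcosets N \<Longrightarrow> \<exists>g\<in>T. g <# d = d'"
      using rcosets_transitive[OF nN fN] by blast
    let ?m = "real (card (rcosets N))"
    have m: "?m \<ge> 1" using H.index_pos[OF N] by linarith
    \<comment> \<open>The pushforward estimate loses a factor \<open>?m\<close>, the index of
      \<open>N\<close>.\<close>
    define \<eta> where "\<eta> = \<delta> / ?m"
    have \<eta>: "0 < \<eta>" "\<eta> \<le> \<delta>" "?m * \<eta> = \<delta>" using \<delta> m by (auto simp: \<eta>_def field_simps)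
    \<comment> \<open>Inverses occur because \<open>c\<close> lies in the translate of a set by
      \<open>g\<close> exactly when \<open>inv g <# c\<close> lies in the set; \<open>T\<close>
      supplies transitivity on \<open>G/N\<close>.\<close>
    define E' where "E' = (\<lambda>g. inv g) ` E \<union> T"
    have E': "finite E'" "E' \<subseteq> carrier G" using E T by (auto simp: E'_def)
    obtain K \<phi> where K: "K \<in> \<N>\<^sub>1" and \<phi>: "\<phi> \<in> rcosets K \<rightarrow> rcosets N"
      and small: "\<And>g. g \<in> E' \<Longrightarrow> card (defect G K \<phi> (\<lambda>d. g <# d) g) \<le> \<eta> * card (rcosets K)"
      using approx[OF N E' \<eta>(1)] by blast
    note nK = F.normal[OF K] and fK = F.finite_index[OF K]
    let ?k = "real (card (rcosets K))"
    have k: "?k > 0" using F.index_pos[OF K] by simp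
    define B where "B i = F.cyl K {c \<in> rcosets K. \<phi> c \<in> S i}" for i
    have main: "\<bar>measure M\<^sub>1 (comp_act G \<N>\<^sub>1 g ` B i \<inter> B j) - measure M\<^sub>2 (comp_act G \<N>\<^sub>2 g ` A i \<inter> A j)\<bar> < \<epsilon>"
      if ij: "i < n" "j < n" and g: "g \<in> E" for i j g
    proof -
      have gG: "g \<in> carrier G" using g E by blast
      have Si: "S i \<subseteq> rcosets N" "S j \<subseteq> rcosets N" using S ij by auto
      define R where "R = (\<lambda>d. g <# d) ` S i \<inter> S j"
      have R: "R \<subseteq> rcosets N" using Si by (auto simp: R_def)
      have sA: "A i \<in> sets M\<^sub>2" "A j \<in> sets M\<^sub>2" using A ij by auto
      have sC: "C i \<in> sets M\<^sub>2" "C j \<in> sets M\<^sub>2" using C ij H.cyl_algebra_sets by auto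
      have "comp_act G \<N>\<^sub>2 g ` (A i - C i \<union> (C i - A i))
          = comp_act G \<N>\<^sub>2 g ` A i - comp_act G \<N>\<^sub>2 g ` C i \<union> (comp_act G \<N>\<^sub>2 g ` C i - comp_act G \<N>\<^sub>2 g ` A i)"
        using inj_on_image_set_diff[OF bij_betw_imp_inj_on[OF H.comp_act_bij[OF gG]]]
          sets.sets_into_space[OF sA(1)] sets.sets_into_space[OF sC(1)] H.space_M
        by (auto simp: image_Un)
      then have "measure M\<^sub>2 (comp_act G \<N>\<^sub>2 g ` A i - comp_act G \<N>\<^sub>2 g ` C i \<union> (comp_act G \<N>\<^sub>2 g ` C i - comp_act G \<N>\<^sub>2 g ` A i)) < \<delta>"
        using H.invariant[OF gG, of "A i - C i \<union> (C i - A i)"] sA sC C(2)[OF ij(1)] by simp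
      then have e1: "\<bar>measure M\<^sub>2 (comp_act G \<N>\<^sub>2 g ` A i \<inter> A j) - measure M\<^sub>2 (comp_act G \<N>\<^sub>2 g ` C i \<inter> C j)\<bar> < 2 * \<delta>"
        using H.measure_Int_symdiff[of "comp_act G \<N>\<^sub>2 g ` A i" "A j" "comp_act G \<N>\<^sub>2 g ` C i" "C j"]
          H.invariant[OF gG] sA sC C(2)[OF ij(2)] by fastforce
      have "comp_act G \<N>\<^sub>2 g ` C i \<inter> C j = H.cyl N R"
        using S ij H.comp_act_cyl[OF gG N Si(1)] by (auto simp: H.cyl_def R_def)
      then have e2: "measure M\<^sub>2 (comp_act G \<N>\<^sub>2 g ` C i \<inter> C j) = card R / ?m"
        using H.measure_cyl[OF N R] by simp
      \<comment> \<open>\<open>X\<close> describes the intersection on the source side and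
        \<open>Y\<close> the preimage of the one on the target side. They differ only inside the
        defect of \<open>inv g\<close>.\<close>
      define X where "X = {c \<in> rcosets K. \<phi> (inv g <# c) \<in> S i \<and> \<phi> c \<in> S j}"
      define Y where "Y = {c \<in> rcosets K. \<phi> c \<in> R}"
      have img: "(\<lambda>c. g <# c) ` {c \<in> rcosets K. \<phi> c \<in> S i} = {c \<in> rcosets K. \<phi> (inv g <# c) \<in> S i}"
      proof (intro equalityI subsetI)
        fix c assume "c \<in> {c \<in> rcosets K. \<phi> (inv g <# c) \<in> S i}"
        then show "c \<in> (\<lambda>c. g <# c) ` {c \<in> rcosets K. \<phi> c \<in> S i}"
          using l_coset_inv(2)[OF nK _ gG] l_coset_closed[OF nK inv_closed[OF gG]]
          by (intro image_eqI[of _ _ "inv g <# c"]) auto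
      qed (use l_coset_inv(1)[OF nK _ gG] l_coset_closed[OF nK gG] in auto)
      have "comp_act G \<N>\<^sub>1 g ` B i \<inter> B j = F.cyl K X"
        unfolding B_def F.comp_act_cyl[OF gG K Collect_restrict] img by (auto simp: F.cyl_def X_def)
      then have e3: "measure M\<^sub>1 (comp_act G \<N>\<^sub>1 g ` B i \<inter> B j) = card X / ?k"
        using F.measure_cyl[OF K, of X] by (auto simp: X_def)
      have eq: "inv g <# d \<in> S i \<and> d \<in> S j \<longleftrightarrow> d \<in> R" if "d \<in> rcosets N" for d
      proof
        assume "inv g <# d \<in> S i \<and> d \<in> S j"
        then show "d \<in> R"
          unfolding R_def using l_coset_inv(2)[OF nN that gG]
          by (intro IntI image_eqI[of d _ "inv g <# d"]) simp_all
      next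
        assume "d \<in> R"
        then obtain s where "s \<in> S i" "d = g <# s" "d \<in> S j" by (auto simp: R_def)
        then show "inv g <# d \<in> S i \<and> d \<in> S j"
          using l_coset_inv(1)[OF nN _ gG, of s] Si by auto
      qed
      have "\<bar>real (card X) - real (card Y)\<bar> \<le> card (defect G K \<phi> (\<lambda>d. inv g <# d) (inv g))"
      proof (rule abs_card_diff_le)
        have "c \<in> X \<longleftrightarrow> c \<in> Y" if c: "c \<in> rcosets K" "\<phi> (inv g <# c) = inv g <# \<phi> c" for c
          using eq[of "\<phi> c"] c \<phi> unfolding X_def Y_def by auto
        then show "X - Y \<subseteq> defect G K \<phi> (\<lambda>d. inv g <# d) (inv g)" "Y - X \<subseteq> defect G K \<phi> (\<lambda>d. inv g <# d) (inv g)"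
          unfolding defect_def X_def Y_def by blast+
      qed (use fK in \<open>auto simp: X_def Y_def defect_def\<close>)
      also have "\<dots> \<le> \<eta> * ?k" by (rule small) (use g in \<open>auto simp: E'_def\<close>)
      finally have "\<bar>real (card X) - real (card Y)\<bar> / ?k \<le> \<eta>" using k by (simp add: divide_le_eq)
      moreover have "\<bar>card X / ?k - card Y / ?k\<bar> = \<bar>real (card X) - real (card Y)\<bar> / ?k"
        using k by (simp add: diff_divide_distrib[symmetric])
      ultimately have e4: "\<bar>card X / ?k - card Y / ?k\<bar> \<le> \<delta>" using \<eta>(2) by linarith
      have "\<bar>card Y / ?k - card R / ?m\<bar> \<le> ?m * \<eta>"
        unfolding Y_def
        by (rule near_uniform_pushforward[OF nK fK nN fN \<phi> T(2,3) _ R])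
           (use small in \<open>auto simp: E'_def\<close>)
      then show ?thesis using e1 e2 e3 e4 \<eta>(3) \<delta> unfolding \<delta>_def by linarith
    qed
    have "B i \<in> sets M\<^sub>1" for i unfolding B_def by (rule F.cyl_sets[OF K]) auto
    then show "\<exists>B. (\<forall>i<n. B i \<in> sets M\<^sub>1) \<and>
        (\<forall>i<n. \<forall>j<n. \<forall>\<gamma>\<in>E. \<bar>measure M\<^sub>1 (comp_act G \<N>\<^sub>1 \<gamma> ` B i \<inter> B j) - measure M\<^sub>2 (comp_act G \<N>\<^sub>2 \<gamma> ` A i \<inter> A j)\<bar> < \<epsilon>)"
      using main by blast
  qed
qed

section \<open>Free groups\<close>

text \<open>The recursion step of \<open>reduce\<close>: left multiplication of a reduced word by
  one letter.\<close>

definition rcons :: "nat \<times> bool \<Rightarrow> (nat \<times> bool) list \<Rightarrow> (nat \<times> bool) list" where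
  "rcons x ys = (case ys of [] \<Rightarrow> [x]
      | y # zs \<Rightarrow> (if fst x = fst y \<and> snd x \<noteq> snd y then zs else x # y # zs))"

abbreviation flip :: "nat \<times> bool \<Rightarrow> nat \<times> bool" where
  "flip x \<equiv> (fst x, \<not> snd x)"

abbreviation reduced :: "(nat \<times> bool) list \<Rightarrow> bool" where
  "reduced \<equiv> successively (\<lambda>x y. y \<noteq> flip x)"

lemma reduce_Cons: "reduce (x # xs) = rcons x (reduce xs)"
  by (simp add: rcons_def)

lemma rcons_reduced: "reduced ys \<Longrightarrow> reduced (rcons x ys)"
  by (auto simp: rcons_def successively_Cons split: list.splits)

lemma reduced_reduce: "reduced (reduce xs)"
  by (induction xs) (simp_all add: reduce_Cons rcons_reduced del: reduce.simps(2))

lemma rcons_eq_Cons: "reduced (x # ys) \<Longrightarrow> rcons x ys = x # ys"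
  by (cases ys) (auto simp: rcons_def successively_Cons prod_eq_iff)

lemma reduce_eq_iff: "reduce xs = xs \<longleftrightarrow> reduced xs"
proof
  show "reduced xs \<Longrightarrow> reduce xs = xs"
    by (induction xs) (auto simp: reduce_Cons successively_Cons rcons_eq_Cons simp del: reduce.simps(2))
qed (metis reduced_reduce)

lemma reduce_reduce: "reduce (reduce xs) = reduce xs"
  by (simp add: reduce_eq_iff reduced_reduce)

text \<open>Letters act on reduced words by permutations. If \<open>flip x\<close> cancels the head
  of \<open>ys\<close>, the remaining tail cannot start with \<open>flip x\<close>, so
  \<open>x\<close> is put back unchanged.\<close>

lemma rcons_flip: "reduced ys \<Longrightarrow> rcons x (rcons (flip x) ys) = ys"
  by (cases ys) (auto simp: rcons_def successively_Cons prod_eq_iff split: list.splits)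

lemma reduce_append_right: "reduce (xs @ reduce ys) = reduce (xs @ ys)"
  by (induction xs) (simp_all add: reduce_reduce reduce_Cons del: reduce.simps(2))

lemma rcons_cases:
  obtains "rcons x ys = x # ys" | zs where "ys = flip x # zs" "rcons x ys = zs"
proof (cases "\<exists>zs. ys = flip x # zs")
  case True
  then obtain zs where "ys = flip x # zs" by blast
  then show ?thesis using that(2) by (simp add: rcons_def)
next
  case False
  have "rcons x ys = x # ys"
  proof (cases ys)
    case (Cons y zs)
    then have "\<not> (fst x = fst y \<and> snd x \<noteq> snd y)" using False by (cases y) auto
    then show ?thesis unfolding rcons_def Cons by simp
  qed (simp add: rcons_def)
  then show ?thesis by (rule that(1))
qed

text \<open>The source of associativity. When \<open>x\<close> cancels against the head of
  \<open>reduce xs\<close>, reducing the unreduced word applies \<open>flip x\<close> and then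
  \<open>x\<close>, which \<open>rcons_flip\<close> undoes.\<close>

lemma reduce_append_left: "reduce (reduce xs @ ys) = reduce (xs @ ys)"
proof (induction xs)
  case (Cons x xs)
  show ?case
  proof (cases x "reduce xs" rule: rcons_cases)
    case 1
    then show ?thesis using Cons by (simp add: reduce_Cons del: reduce.simps(2))
  next
    case (2 zs)
    have "reduce (xs @ ys) = reduce (flip x # (zs @ ys))" using Cons 2 by simp
    then have "reduce ((x # xs) @ ys) = rcons x (rcons (flip x) (reduce (zs @ ys)))"
      by (simp add: reduce_Cons del: reduce.simps(2))
    then show ?thesis
      using 2 by (simp add: reduce_Cons rcons_flip reduced_reduce del: reduce.simps(2))
  qed
qed simp

lemma set_reduce: "set (reduce xs) \<subseteq> set xs"
  by (induction xs) (auto split: list.splits if_splits)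

definition word_inv :: "(nat \<times> bool) list \<Rightarrow> (nat \<times> bool) list" where
  "word_inv xs = rev (map (\<lambda>x. flip x) xs)"

lemma reduce_word_inv: "reduce (word_inv xs @ xs) = []"
proof (induction xs)
  case (Cons x xs)
  have "reduce (flip x # x # xs) = reduce xs"
    using rcons_flip[OF reduced_reduce, of "flip x" xs] by (simp add: reduce_Cons del: reduce.simps(2))
  then have "reduce (word_inv xs @ flip x # x # xs) = reduce (word_inv xs @ xs)"
    by (metis reduce_append_right)
  then show ?case using Cons by (simp add: word_inv_def)
qed (simp add: word_inv_def)

lemma free_group_simps:
  "w \<in> carrier (free_group n) \<longleftrightarrow> set w \<subseteq> {..<n} \<times> UNIV \<and> reduce w = w"
  "v \<otimes>\<^bsub>free_group n\<^esub> w = reduce (v @ w)" "\<one>\<^bsub>free_group n\<^esub> = []"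
  by (simp_all add: free_group_def)

lemma group_free_group: "group (free_group n)"
proof (rule groupI)
  fix x y assume "x \<in> carrier (free_group n)" "y \<in> carrier (free_group n)"
  then show "x \<otimes>\<^bsub>free_group n\<^esub> y \<in> carrier (free_group n)"
    using set_reduce[of "x @ y"] by (auto simp: free_group_simps reduce_reduce)
next
  fix x y z assume "x \<in> carrier (free_group n)" "y \<in> carrier (free_group n)" "z \<in> carrier (free_group n)"
  then show "x \<otimes>\<^bsub>free_group n\<^esub> y \<otimes>\<^bsub>free_group n\<^esub> z = x \<otimes>\<^bsub>free_group n\<^esub> (y \<otimes>\<^bsub>free_group n\<^esub> z)"
    by (simp add: free_group_simps reduce_append_left reduce_append_right)
next
  fix x assume x: "x \<in> carrier (free_group n)"
  then show "\<one>\<^bsub>free_group n\<^esub> \<otimes>\<^bsub>free_group n\<^esub> x = x" by (simp add: free_group_simps)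
  have "set (reduce (word_inv x)) \<subseteq> {..<n} \<times> UNIV"
    using set_reduce[of "word_inv x"] x by (force simp: free_group_simps word_inv_def)
  then show "\<exists>y\<in>carrier (free_group n). y \<otimes>\<^bsub>free_group n\<^esub> x = \<one>\<^bsub>free_group n\<^esub>"
    using reduce_word_inv[of x]
    by (intro bexI[of _ "reduce (word_inv x)"]) (auto simp: free_group_simps reduce_reduce reduce_append_left)
qed (simp add: free_group_simps)

abbreviation gen :: "nat \<Rightarrow> (nat \<times> bool) list" where
  "gen i \<equiv> [(i, True)]"

lemma gen_carrier: "i < n \<Longrightarrow> gen i \<in> carrier (free_group n)"
  by (simp add: free_group_simps)

lemma gen_inv: "i < n \<Longrightarrow> inv\<^bsub>free_group n\<^esub> gen i = [(i, False)]"
  by (rule group.inv_equality[OF group_free_group]) (simp_all add: free_group_simps)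

text \<open>In a reduced word nothing cancels at the head, so consing a letter is multiplication by
  a generator or its inverse.\<close>

lemma free_group_induct [consumes 1, case_names one mult]:
  assumes "w \<in> carrier (free_group n)"
    and "P []"
    and step: "\<And>s w. (\<exists>i<n. s = gen i \<or> s = inv\<^bsub>free_group n\<^esub> gen i) \<Longrightarrow> w \<in> carrier (free_group n) \<Longrightarrow> P w
      \<Longrightarrow> P (s \<otimes>\<^bsub>free_group n\<^esub> w)"
  shows "P w"
  using assms(1)
proof (induction w)
  case (Cons x w)
  have red: "reduced (x # w)" and x: "fst x < n"
    using Cons.prems unfolding free_group_simps reduce_eq_iff by auto
  have w: "w \<in> carrier (free_group n)"
    using Cons.prems red unfolding free_group_simps reduce_eq_iff by (auto simp: successively_Cons)
  have "[x] = gen (fst x) \<or> [x] = inv\<^bsub>free_group n\<^esub> gen (fst x)"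
    using gen_inv[OF x] by (cases x) auto
  then have "P ([x] \<otimes>\<^bsub>free_group n\<^esub> w)" using step[OF _ w Cons.IH[OF w]] x by blast
  moreover have "[x] \<otimes>\<^bsub>free_group n\<^esub> w = x # w"
    using red by (simp add: free_group_simps(2) reduce_eq_iff[symmetric])
  ultimately show ?case by simp
qed (rule assms(2))

section \<open>Evaluation of words and the universal property\<close>

definition (in group) word_eval :: "(nat \<Rightarrow> 'a) \<Rightarrow> (nat \<times> bool) list \<Rightarrow> 'a" where
  "word_eval q w = foldr (\<lambda>x a. (if snd x then q (fst x) else inv q (fst x)) \<otimes> a) w \<one>"

context group
begin

lemma word_eval_closed:
  assumes "\<forall>i. q i \<in> carrier G" shows "word_eval q w \<in> carrier G"
  by (induction w) (simp_all add: word_eval_def assms)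

lemma word_eval_rcons:
  assumes q: "\<forall>i. q i \<in> carrier G"
  shows "word_eval q (rcons x w) = word_eval q (x # w)"
proof (cases x w rule: rcons_cases)
  case (2 zs)
  then show ?thesis
    using word_eval_closed[OF q, of zs] q by (simp add: word_eval_def m_assoc[symmetric])
qed simp

lemma word_eval_reduce:
  assumes q: "\<forall>i. q i \<in> carrier G"
  shows "word_eval q (reduce w) = word_eval q w"
proof (induction w)
  case (Cons x w)
  then show ?case
    by (simp add: reduce_Cons word_eval_rcons[OF q] del: reduce.simps(2)) (simp add: word_eval_def)
qed simp

lemma word_eval_append:
  assumes q: "\<forall>i. q i \<in> carrier G"
  shows "word_eval q (v @ w) = word_eval q v \<otimes> word_eval q w"
proof (induction v)
  case Nil
  then show ?case using word_eval_closed[OF q] by (simp add: word_eval_def)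
next
  case (Cons x v)
  then show ?case
    using word_eval_closed[OF q, of v] word_eval_closed[OF q, of w] q
    by (simp add: word_eval_def m_assoc)
qed

lemma word_eval_hom:
  assumes q: "\<forall>i. q i \<in> carrier G"
  shows "group_hom (free_group n) G (word_eval q)"
  by (intro group_hom.intro group_hom_axioms.intro group_free_group is_group)
     (simp add: hom_def word_eval_closed[OF q] free_group_simps word_eval_reduce[OF q] word_eval_append[OF q])

lemma word_eval_gen: "q i \<in> carrier G \<Longrightarrow> word_eval q (gen i) = q i"
  by (simp add: word_eval_def)

end

section \<open>Finite quotients of prime power order\<close>

context group
begin

text \<open>The class equation. Without a nontrivial central element, every conjugacy class except
  that of \<open>\<one>\<close> has size a positive power of \<open>p\<close>, so
  \<open>p ^ k\<close> would be 1 modulo \<open>p\<close>.\<close>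

lemma p_group_center:
  assumes p: "prime p" and ord: "Coset.order G = p ^ k" and k: "k > 0"
  shows "\<exists>z\<in>carrier G. z \<noteq> \<one> \<and> (\<forall>g\<in>carrier G. g \<otimes> z = z \<otimes> g)"
proof (rule ccontr)
  assume no: "\<not> ?thesis"
  let ?c = "\<lambda>g. \<lambda>h\<in>carrier G. g \<otimes> h \<otimes> inv g"
  let ?O = "orbits G (carrier G) ?c"
  interpret act: group_action G "carrier G" ?c by (rule action_by_conjugation)
  interpret part: partition "carrier G" ?O by (rule act.orbit_partition)
  have "Coset.order G > 0" using ord p prime_gt_0_nat by simp
  then have fin: "finite (carrier G)" using order_gt_0_iff_finite by blast
  have finO: "finite ?O" by (simp add: orbits_def fin setcompr_eq_image)
  have one: "orbit G ?c \<one> = {\<one>}"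
    by (auto simp: orbit_def intro!: exI[of _ \<one>])
  have oneO: "{\<one>} \<in> ?O" unfolding orbits_def using one by (metis (mono_tags, lifting) mem_Collect_eq one_closed)
  have pd: "p dvd card B" if B: "B \<in> ?O - {{\<one>}}" for B
  proof -
    obtain x where x: "x \<in> carrier G" "B = orbit G ?c x" using B by (auto simp: orbits_def)
    then have "x \<noteq> \<one>" using B one by auto
    have "card B dvd p ^ k"
      unfolding x(2) ord[symmetric] act.orbit_stabilizer_theorem[OF x(1), symmetric] by (rule dvd_triv_left)
    then obtain j where j: "card B = p ^ j" using divides_primepow_nat[OF p] by blast
    obtain g where g: "g \<in> carrier G" "g \<otimes> x \<noteq> x \<otimes> g" using no x \<open>x \<noteq> \<one>\<close> by blast
    have "g \<otimes> x \<otimes> inv g \<noteq> x"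
    proof
      assume "g \<otimes> x \<otimes> inv g = x"
      then have "g \<otimes> x \<otimes> inv g \<otimes> g = x \<otimes> g" by simp
      then show False using g x by (simp add: m_assoc)
    qed
    moreover have "g \<otimes> x \<otimes> inv g \<in> B" using x g by (auto simp: orbit_def)
    moreover have "x \<in> B"
      unfolding x(2) orbit_def using x(1) by (intro CollectI exI[of _ \<one>]) simp
    ultimately have "card B \<noteq> 1" using \<open>g \<otimes> x \<otimes> inv g \<noteq> x\<close> by (auto simp: card_1_singleton_iff)
    then have "j > 0" unfolding j by (cases "j = 0") simp_all
    then show ?thesis unfolding j by (intro dvd_power disjI1)
  qed
  have "card (\<Union>?O) = (\<Sum>B\<in>?O. card B)"
  proof (rule card_Union_disjoint)
    show "pairwise disjnt ?O"
      unfolding pairwise_def disjnt_def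
    proof (intro ballI impI)
      fix X Y assume "X \<in> ?O" "Y \<in> ?O" "X \<noteq> Y"
      show "X \<inter> Y = {}"
      proof (rule ccontr)
        assume "X \<inter> Y \<noteq> {}"
        from part.disjoint_union[OF \<open>X \<in> ?O\<close> \<open>Y \<in> ?O\<close> this] \<open>X \<noteq> Y\<close> show False by (rule notE[rotated])
      qed
    qed
    show "finite B" if "B \<in> ?O" for B
      by (rule finite_subset[OF part.incl[OF that] fin])
  qed
  then have "card (carrier G) = (\<Sum>B\<in>?O. card B)" using part.partition_coverture by simp
  also have "\<dots> = 1 + (\<Sum>B\<in>?O - {{\<one>}}. card B)"
    by (simp add: sum.remove[OF finO oneO])
  finally have "p ^ k = 1 + (\<Sum>B\<in>?O - {{\<one>}}. card B)" using ord by (simp add: Coset.order_def)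
  moreover have "p dvd (\<Sum>B\<in>?O - {{\<one>}}. card B)" using pd by (rule dvd_sum)
  moreover have "p dvd p ^ k" using k by (simp add: dvd_power)
  ultimately have "p dvd 1" using dvd_add_left_iff[of p "\<Sum>B\<in>?O - {{\<one>}}. card B" 1] by simp
  then show False using p by (simp add: prime_nat_iff)
qed

text \<open>Take a largest normal subgroup \<open>Z\<close> whose iterated derived subgroups become
  trivial. If it were proper, the preimage of the centre of \<open>G/Z\<close> would be a larger
  one.\<close>

lemma p_group_solvable:
  assumes p: "prime p" and ord: "Coset.order G = p ^ k"
  shows "solvable G"
proof -
  have "Coset.order G > 0" using ord p prime_gt_0_nat by simp
  then have fin: "finite (carrier G)" using order_gt_0_iff_finite by blast
  define P where "P Z \<longleftrightarrow> Z \<lhd> G \<and> (\<exists>n. (derived G ^^ n) Z \<subseteq> {\<one>})" for Z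
  have "P {\<one>}" unfolding P_def using one_is_normal by (auto intro: exI[of _ 0])
  have "finite {Z. P Z}"
    by (rule finite_subset[of _ "Pow (carrier G)"])
       (use fin subgroup.subset[OF normal_imp_subgroup] in \<open>auto simp: P_def\<close>)
  then have finP: "finite (card ` {Z. P Z})" by (rule finite_imageI)
  then have "Max (card ` {Z. P Z}) \<in> card ` {Z. P Z}"
    by (rule Max_in) (use \<open>P {\<one>}\<close> in blast)
  then obtain Z where Z: "P Z" and "Max (card ` {Z. P Z}) = card Z" by blast
  then have max: "card Z' \<le> card Z" if "P Z'" for Z'
    using Max_ge[OF finP, of "card Z'"] that by simp
  interpret Z: normal Z G using Z by (simp add: P_def)
  let ?H = "G Mod Z"
  interpret H: group ?H by (rule Z.factorgroup_is_group)
  interpret \<pi>: group_hom G ?H "\<lambda>a. Z #> a"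
    by (intro group_hom.intro group_hom_axioms.intro is_group H.is_group Z.r_coset_hom_Mod)
  have surj: "\<exists>g\<in>carrier G. h = Z #> g" if "h \<in> carrier ?H" for h
    using that by (auto simp: carrier_FactGroup)
  have "Z = carrier G"
  proof (rule ccontr)
    assume ne: "Z \<noteq> carrier G"
    have "Coset.order ?H * card Z = p ^ k"
      using lagrange[OF Z.subgroup_axioms] ord by (simp add: Coset.order_def FactGroup_def)
    then obtain j where j: "Coset.order ?H = p ^ j" using divides_primepow_nat[OF p] by (metis dvd_triv_left)
    have "j > 0"
    proof (rule ccontr)
      assume "\<not> j > 0"
      then have "card Z = card (carrier G)"
        using \<open>Coset.order ?H * card Z = p ^ k\<close> j ord by (simp add: Coset.order_def)
      then show False using ne card_subset_eq[OF fin Z.subset] by blast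
    qed
    obtain z where z: "z \<in> carrier ?H" "z \<noteq> \<one>\<^bsub>?H\<^esub>" "\<forall>h\<in>carrier ?H. h \<otimes>\<^bsub>?H\<^esub> z = z \<otimes>\<^bsub>?H\<^esub> h"
      using H.p_group_center[OF p j \<open>j > 0\<close>] by blast
    obtain g\<^sub>0 where g0: "g\<^sub>0 \<in> carrier G" "z = Z #> g\<^sub>0" using surj z by blast
    \<comment> \<open>The preimage of the centre of \<open>G/Z\<close>. Its commutators fall into
      \<open>Z\<close>, so its derived series ends one step after that of \<open>Z\<close>; the
      central element \<open>z\<close> makes it strictly larger.\<close>
    define Z' where "Z' = {g \<in> carrier G. \<forall>h\<in>carrier ?H. h \<otimes>\<^bsub>?H\<^esub> (Z #> g) = (Z #> g) \<otimes>\<^bsub>?H\<^esub> h}"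
    have sub: "subgroup Z' G"
    proof (rule subgroupI)
      show "Z' \<subseteq> carrier G" by (auto simp: Z'_def)
      have "\<one> \<in> Z'" unfolding Z'_def using \<pi>.hom_one by (simp del: one_FactGroup mult_FactGroup)
      then show "Z' \<noteq> {}" by blast
      fix a assume a: "a \<in> Z'"
      then have aG: "a \<in> carrier G" by (simp add: Z'_def)
      have "h \<otimes>\<^bsub>?H\<^esub> inv\<^bsub>?H\<^esub> (Z #> a) = inv\<^bsub>?H\<^esub> (Z #> a) \<otimes>\<^bsub>?H\<^esub> h" if h: "h \<in> carrier ?H" for h
      proof -
        have "h \<otimes>\<^bsub>?H\<^esub> (Z #> a) = (Z #> a) \<otimes>\<^bsub>?H\<^esub> h" using a h by (simp add: Z'_def)
        then show ?thesis using h \<pi>.hom_closed[OF aG]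
          by (metis H.inv_closed H.inv_solve_left H.inv_solve_right H.m_assoc H.m_closed)
      qed
      then show "inv a \<in> Z'" unfolding Z'_def using aG \<pi>.hom_inv[OF aG] by simp
      fix b assume b: "b \<in> Z'"
      then have bG: "b \<in> carrier G" by (simp add: Z'_def)
      have "h \<otimes>\<^bsub>?H\<^esub> ((Z #> a) \<otimes>\<^bsub>?H\<^esub> (Z #> b)) = ((Z #> a) \<otimes>\<^bsub>?H\<^esub> (Z #> b)) \<otimes>\<^bsub>?H\<^esub> h" if h: "h \<in> carrier ?H" for h
      proof -
        have "h \<otimes>\<^bsub>?H\<^esub> (Z #> a) = (Z #> a) \<otimes>\<^bsub>?H\<^esub> h" "h \<otimes>\<^bsub>?H\<^esub> (Z #> b) = (Z #> b) \<otimes>\<^bsub>?H\<^esub> h"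
          using a b h by (simp_all add: Z'_def)
        then show ?thesis using h \<pi>.hom_closed[OF aG] \<pi>.hom_closed[OF bG] by (metis H.m_assoc)
      qed
      then show "a \<otimes> b \<in> Z'" unfolding Z'_def using aG bG \<pi>.hom_mult[OF aG bG] by simp
    qed
    have "Z' \<lhd> G"
      unfolding normal_inv_iff
    proof (intro conjI sub ballI)
      fix x h assume x: "x \<in> carrier G" and h: "h \<in> Z'"
      then have hG: "h \<in> carrier G" by (simp add: Z'_def)
      have "Z #> (x \<otimes> h \<otimes> inv x) = (Z #> x) \<otimes>\<^bsub>?H\<^esub> (Z #> h) \<otimes>\<^bsub>?H\<^esub> inv\<^bsub>?H\<^esub> (Z #> x)"
        using x hG by (simp only: \<pi>.hom_mult m_closed inv_closed \<pi>.hom_inv)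
      also have "\<dots> = (Z #> h) \<otimes>\<^bsub>?H\<^esub> (Z #> x) \<otimes>\<^bsub>?H\<^esub> inv\<^bsub>?H\<^esub> (Z #> x)"
        using h \<pi>.hom_closed[OF x] by (simp add: Z'_def)
      also have "\<dots> = Z #> h"
        using \<pi>.hom_closed[OF x] \<pi>.hom_closed[OF hG] by (simp only: H.m_assoc H.inv_closed H.r_inv H.r_one)
      finally show "x \<otimes> h \<otimes> inv x \<in> Z'" using x h hG by (simp add: Z'_def)
    qed
    moreover have "derived G Z' \<subseteq> Z"
      unfolding derived_def
    proof (rule generate_subgroup_incl[OF _ Z.subgroup_axioms])
      show "derived_set G Z' \<subseteq> Z"
      proof (safe)
        fix a b assume a: "a \<in> Z'" and b: "b \<in> Z'"
        then have G: "a \<in> carrier G" "b \<in> carrier G" by (auto simp: Z'_def)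
        note A = \<pi>.hom_closed[OF G(1)] and B = \<pi>.hom_closed[OF G(2)]
        have "Z #> (a \<otimes> b \<otimes> inv a \<otimes> inv b) = (Z #> a) \<otimes>\<^bsub>?H\<^esub> (Z #> b) \<otimes>\<^bsub>?H\<^esub> inv\<^bsub>?H\<^esub> (Z #> a) \<otimes>\<^bsub>?H\<^esub> inv\<^bsub>?H\<^esub> (Z #> b)"
          using G by (simp only: \<pi>.hom_mult m_closed inv_closed \<pi>.hom_inv)
        also have "(Z #> a) \<otimes>\<^bsub>?H\<^esub> (Z #> b) = (Z #> b) \<otimes>\<^bsub>?H\<^esub> (Z #> a)" using b A by (simp add: Z'_def)
        also have "(Z #> b) \<otimes>\<^bsub>?H\<^esub> (Z #> a) \<otimes>\<^bsub>?H\<^esub> inv\<^bsub>?H\<^esub> (Z #> a) \<otimes>\<^bsub>?H\<^esub> inv\<^bsub>?H\<^esub> (Z #> b) = \<one>\<^bsub>?H\<^esub>"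
          using A B by (simp only: H.m_assoc H.inv_closed H.r_inv H.r_one H.m_closed)
        finally have "Z #> (a \<otimes> b \<otimes> inv a \<otimes> inv b) = Z" by simp
        then show "a \<otimes> b \<otimes> inv a \<otimes> inv b \<in> Z"
          using rcos_self[of "a \<otimes> b \<otimes> inv a \<otimes> inv b" Z] G Z.subgroup_axioms by simp
      qed
    qed
    moreover obtain n where n: "(derived G ^^ n) Z \<subseteq> {\<one>}" using Z by (auto simp: P_def)
    ultimately have "(derived G ^^ Suc n) Z' \<subseteq> {\<one>}"
      using mono_exp_of_derived[of "derived G Z'" Z n] by (simp add: funpow_swap1)
    then have "P Z'" unfolding P_def using \<open>Z' \<lhd> G\<close> by blast
    have "Z \<subseteq> Z'"
    proof
      fix a assume a: "a \<in> Z"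
      then have "Z #> a = \<one>\<^bsub>?H\<^esub>" using Z.rcos_const[OF is_group] by simp
      then show "a \<in> Z'" using a by (simp add: Z'_def del: one_FactGroup mult_FactGroup)
    qed
    moreover have "g\<^sub>0 \<in> Z'" using g0 z by (simp add: Z'_def)
    moreover have "g\<^sub>0 \<notin> Z"
    proof
      assume "g\<^sub>0 \<in> Z"
      then have "Z #> g\<^sub>0 = Z" using Z.rcos_const[OF is_group] by simp
      then show False using g0 z by simp
    qed
    ultimately have "Z \<subset> Z'" by blast
    moreover have "finite Z'" using fin by (simp add: Z'_def)
    ultimately have "card Z < card Z'" by (simp add: psubset_card_mono)
    then show False using max[OF \<open>P Z'\<close>] by simp
  qed
  then obtain n where n: "(derived G ^^ n) (carrier G) \<subseteq> {\<one>}" using Z by (auto simp: P_def)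
  have "\<one> \<in> (derived G ^^ n) (carrier G)"
    by (rule subgroup.one_closed[OF exp_of_derived_is_subgroup[OF subgroup_self]])
  then have "(derived G ^^ n) (carrier G) = {\<one>}" using n by blast
  then show ?thesis unfolding solvable_iff_trivial_derived_seq by (rule exI)
qed

end

section \<open>Kernels and the two families of normal subgroups\<close>

lemma (in group_hom) the_elem_kernel_coset:
  assumes g: "g \<in> carrier G"
  shows "the_elem (h ` (kernel G H h #> g)) = h g"
proof -
  have "h ` (kernel G H h #> g) = {h g}"
  proof
    show "h ` (kernel G H h #> g) \<subseteq> {h g}"
    proof
      fix y assume "y \<in> h ` (kernel G H h #> g)"
      then obtain k where k: "k \<in> kernel G H h" "y = h (k \<otimes> g)" unfolding r_coset_def by blast
      then show "y \<in> {h g}" using g unfolding kernel_def by simp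
    qed
    show "{h g} \<subseteq> h ` (kernel G H h #> g)"
      using imageI[OF G.rcos_self[OF g subgroup_kernel], of h] by simp
  qed
  then show ?thesis by (simp only: the_elem_eq)
qed

lemma (in group_hom) kernel_index: "card (rcosets (kernel G H h)) = card (h ` carrier G)"
proof -
  have "bij_betw (\<lambda>X. the_elem (h ` X)) (carrier (G Mod kernel G H h)) (h ` carrier G)"
    unfolding bij_betw_def
  proof
    have "(\<lambda>g. the_elem (h ` (kernel G H h #> g))) ` carrier G = h ` carrier G"
      by (intro image_cong refl the_elem_kernel_coset)
    then show "(\<lambda>X. the_elem (h ` X)) ` carrier (G Mod kernel G H h) = h ` carrier G"
      by (simp only: carrier_FactGroup image_image)
  qed (rule FactGroup_inj_on)
  from bij_betw_same_card[OF this] show ?thesis unfolding FactGroup_def by (simp only: partial_object.select_convs)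
qed

text \<open>The index of the kernel is the order of the image, which divides \<open>p ^ k\<close> by
  Lagrange.\<close>

lemma (in group_hom) kernel_p_index_normal:
  assumes "prime p" "Coset.order H = p ^ k"
  shows "kernel G H h \<in> p_index_normal G p"
proof -
  have "card (rcosets\<^bsub>H\<^esub> (h ` carrier G)) * card (h ` carrier G) = p ^ k"
    using H.lagrange[OF img_is_subgroup] assms(2) by simp
  then have "card (h ` carrier G) dvd p ^ k" by (metis dvd_triv_right)
  then obtain j where "card (h ` carrier G) = p ^ j"
    unfolding divides_primepow_nat[OF assms(1)] by blast
  with kernel_index have c: "card (rcosets (kernel G H h)) = p ^ j" by (rule trans)
  show ?thesis
    unfolding p_index_normal_def by (rule CollectI, rule conjI, rule normal_kernel, rule exI, rule c)
qed

text \<open>The quotient by the kernel embeds into the finite solvable group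
  \<open>H\<close>.\<close>

lemma (in group_hom) kernel_solv_normal:
  assumes "finite (carrier H)" "solvable H"
  shows "kernel G H h \<in> solv_normal G"
proof -
  interpret K: normal "kernel G H h" G by (rule normal_kernel)
  interpret q: group_hom "G Mod kernel G H h" H "\<lambda>X. the_elem (h ` X)"
    by (rule group_hom.intro[OF K.factorgroup_is_group H.is_group group_hom_axioms.intro[OF FactGroup_hom]])
  have "finite (h ` carrier G)" by (rule finite_subset[OF hom_carrier[OF homh] assms(1)])
  moreover have "h ` carrier G \<noteq> {}" using G.one_closed by blast
  ultimately have "0 < card (rcosets (kernel G H h))" unfolding kernel_index card_gt_0_iff by (intro conjI)
  then have "finite (carrier (G Mod kernel G H h))"
    unfolding FactGroup_def partial_object.select_convs by (rule card_ge_0_finite)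
  moreover have "solvable (G Mod kernel G H h)"
    by (rule q.inj_hom_imp_solvable[OF FactGroup_inj_on assms(2)])
  ultimately show ?thesis unfolding solv_normal_def by (intro CollectI conjI normal_kernel)
qed

text \<open>Presents \<open>N \<inter> K\<close> as the kernel of a homomorphism to the product of
  the two quotients, so that closure of both families under intersection follows from the results on
  kernels.\<close>

lemma (in group) Int_kernel:
  assumes "N \<lhd> G" "K \<lhd> G"
  shows "group_hom G ((G Mod N) \<times>\<times> (G Mod K)) (\<lambda>g. (N #> g, K #> g))"
    and "kernel G ((G Mod N) \<times>\<times> (G Mod K)) (\<lambda>g. (N #> g, K #> g)) = N \<inter> K"
proof -
  interpret N: normal N G by fact
  interpret K: normal K G by fact
  show "group_hom G ((G Mod N) \<times>\<times> (G Mod K)) (\<lambda>g. (N #> g, K #> g))"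
  proof (rule group_hom.intro[OF is_group _ group_hom_axioms.intro])
    show "group ((G Mod N) \<times>\<times> (G Mod K))"
      by (rule DirProd_group[OF N.factorgroup_is_group K.factorgroup_is_group])
    show "(\<lambda>g. (N #> g, K #> g)) \<in> hom G ((G Mod N) \<times>\<times> (G Mod K))"
      unfolding hom_paired by (intro conjI N.r_coset_hom_Mod K.r_coset_hom_Mod)
  qed
  have N1: "N #> g = N \<longleftrightarrow> g \<in> N" if "g \<in> carrier G" for g
    by (rule iffI, erule coset_join1[OF _ that N.subgroup_axioms], erule coset_join2[OF that N.subgroup_axioms])
  have K1: "K #> g = K \<longleftrightarrow> g \<in> K" if "g \<in> carrier G" for g
    by (rule iffI, erule coset_join1[OF _ that K.subgroup_axioms], erule coset_join2[OF that K.subgroup_axioms])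
  show "kernel G ((G Mod N) \<times>\<times> (G Mod K)) (\<lambda>g. (N #> g, K #> g)) = N \<inter> K"
    unfolding kernel_def using N1 K1 N.subset by (auto simp: DirProd_def)
qed

lemma (in group) carrier_p_index_normal: "carrier G \<in> p_index_normal G p"
proof -
  have "rcosets (carrier G) = {carrier G}"
    unfolding RCOSETS_def using coset_join2[OF _ subgroup_self] one_closed by (auto simp: UNION_singleton_eq_range)
  then have "card (rcosets (carrier G)) = p ^ 0" by simp
  then show ?thesis unfolding p_index_normal_def by (intro CollectI conjI normal_self exI)
qed

lemma (in group) profinite_family_p_index_normal:
  assumes p: "prime p"
  shows "profinite_family G (p_index_normal G p)"
proof (intro profinite_family.intro profinite_family_axioms.intro is_group)
  show "p_index_normal G p \<noteq> {}" using carrier_p_index_normal by blast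
  fix N assume N: "N \<in> p_index_normal G p"
  show "N \<lhd> G" using N by (simp add: p_index_normal_def)
  show "finite (rcosets N)"
    using N p prime_gt_0_nat by (auto simp: p_index_normal_def intro!: card_ge_0_finite)
  fix K assume K: "K \<in> p_index_normal G p"
  obtain a b where ab: "card (rcosets N) = p ^ a" "card (rcosets K) = p ^ b"
    using N K unfolding p_index_normal_def by blast
  have nor: "N \<lhd> G" "K \<lhd> G" using N K by (simp_all add: p_index_normal_def)
  have "Coset.order ((G Mod N) \<times>\<times> (G Mod K)) = p ^ (a + b)"
    using ab by (simp add: Coset.order_def DirProd_def FactGroup_def card_cartesian_product power_add)
  then show "N \<inter> K \<in> p_index_normal G p"
    using group_hom.kernel_p_index_normal[OF Int_kernel(1)[OF nor] p] Int_kernel(2)[OF nor] by simp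
qed

text \<open>The product is an extension of \<open>B\<close> by \<open>A\<close>.\<close>

lemma solvable_DirProd:
  assumes "group A" "group B" "solvable A" "solvable B"
  shows "solvable (A \<times>\<times> B)"
proof (rule solvable_condition[of A _ "\<lambda>a. (a, \<one>\<^bsub>B\<^esub>)" B snd])
  interpret A: group A by fact
  interpret B: group B by fact
  show "group_hom A (A \<times>\<times> B) (\<lambda>a. (a, \<one>\<^bsub>B\<^esub>))"
    by (intro group_hom.intro group_hom_axioms.intro assms DirProd_group) (auto simp: hom_def DirProd_def)
  show "group_hom (A \<times>\<times> B) B snd"
    by (intro group_hom.intro group_hom_axioms.intro assms DirProd_group) (auto simp: hom_def DirProd_def)
  show "snd ` carrier (A \<times>\<times> B) = carrier B"
    using A.one_closed by (simp add: DirProd_def) blast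
  show "kernel (A \<times>\<times> B) B snd \<subseteq> (\<lambda>a. (a, \<one>\<^bsub>B\<^esub>)) ` carrier A"
    unfolding kernel_def by auto
qed (use assms in auto)

lemma (in group) p_index_normal_subset_solv_normal:
  assumes p: "prime p"
  shows "p_index_normal G p \<subseteq> solv_normal G"
proof
  fix N assume "N \<in> p_index_normal G p"
  then obtain k where N: "N \<lhd> G" "Coset.order (G Mod N) = p ^ k"
    unfolding p_index_normal_def Coset.order_def FactGroup_def by auto
  then have "solvable (G Mod N)" using group.p_group_solvable[OF normal.factorgroup_is_group p] by blast
  moreover have "finite (carrier (G Mod N))"
    using N(2) p prime_gt_0_nat by (auto simp: Coset.order_def intro!: card_ge_0_finite)
  ultimately show "N \<in> solv_normal G" using N by (simp add: solv_normal_def)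
qed

lemma (in group) profinite_family_solv_normal: "profinite_family G (solv_normal G)"
proof (intro profinite_family.intro profinite_family_axioms.intro is_group)
  show "solv_normal G \<noteq> {}"
    using p_index_normal_subset_solv_normal[OF two_is_prime_nat] profinite_family.nonempty[OF profinite_family_p_index_normal[OF two_is_prime_nat]]
    by blast
  fix N assume N: "N \<in> solv_normal G"
  show "N \<lhd> G" "finite (rcosets N)" using N by (simp_all add: solv_normal_def FactGroup_def)
  fix K assume K: "K \<in> solv_normal G"
  have nor: "N \<lhd> G" "K \<lhd> G" using N K by (simp_all add: solv_normal_def)
  have "solvable ((G Mod N) \<times>\<times> (G Mod K))"
    using N K nor normal.factorgroup_is_group by (intro solvable_DirProd) (auto simp: solv_normal_def)
  moreover have "finite (carrier ((G Mod N) \<times>\<times> (G Mod K)))"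
    using N K by (simp add: solv_normal_def)
  ultimately show "N \<inter> K \<in> solv_normal G"
    using group_hom.kernel_solv_normal[OF Int_kernel(1)[OF nor]] Int_kernel(2)[OF nor] by simp
qed

section \<open>Approximating solvable quotients by quotients of prime power order\<close>

text \<open>The wreath product is written so that \<open>(g, u)\<close> acts on \<open>P \<times> (A \<rightarrow> \<int>/q)\<close> by
  \<open>(x, z) \<mapsto> (g x, z + u (x, -))\<close>, and \<open>(g, u) \<mapsto> (g, u (1, -))\<close> is the orbit map of \<open>(1, 0)\<close>.\<close>

definition wreath :: "('g, 'm) monoid_scheme \<Rightarrow> 'b set \<Rightarrow> nat \<Rightarrow> ('g \<times> ('g \<times> 'b \<Rightarrow> nat)) monoid" where
  "wreath P A q = \<lparr>
     carrier = carrier P \<times> ((carrier P \<times> A) \<rightarrow>\<^sub>E {..<q}),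
     monoid.mult = (\<lambda>(g, u) (g', u'). (g \<otimes>\<^bsub>P\<^esub> g',
       \<lambda>(x, a)\<in>carrier P \<times> A. (u' (x, a) + u (g' \<otimes>\<^bsub>P\<^esub> x, a)) mod q)),
     one = (\<one>\<^bsub>P\<^esub>, \<lambda>_\<in>carrier P \<times> A. 0)\<rparr>"

lemma wreath_simps:
  "carrier (wreath P A q) = carrier P \<times> ((carrier P \<times> A) \<rightarrow>\<^sub>E {..<q})"
  "(g, u) \<otimes>\<^bsub>wreath P A q\<^esub> (g', u') = (g \<otimes>\<^bsub>P\<^esub> g',
     \<lambda>(x, a)\<in>carrier P \<times> A. (u' (x, a) + u (g' \<otimes>\<^bsub>P\<^esub> x, a)) mod q)"
  "\<one>\<^bsub>wreath P A q\<^esub> = (\<one>\<^bsub>P\<^esub>, \<lambda>_\<in>carrier P \<times> A. 0)"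
  by (simp_all add: wreath_def)

lemma group_wreath:
  assumes "group P" and q: "0 < q"
  shows "group (wreath P A q)"
proof -
  interpret P: group P by fact
  show ?thesis
  proof (rule groupI)
    fix v w assume "v \<in> carrier (wreath P A q)" "w \<in> carrier (wreath P A q)"
    then show "v \<otimes>\<^bsub>wreath P A q\<^esub> w \<in> carrier (wreath P A q)"
      using q by (cases v; cases w) (auto simp: wreath_simps)
  next
    show "\<one>\<^bsub>wreath P A q\<^esub> \<in> carrier (wreath P A q)" using q by (auto simp: wreath_simps)
  next
    fix v w z assume "v \<in> carrier (wreath P A q)" "w \<in> carrier (wreath P A q)" "z \<in> carrier (wreath P A q)"
    then show "v \<otimes>\<^bsub>wreath P A q\<^esub> w \<otimes>\<^bsub>wreath P A q\<^esub> z = v \<otimes>\<^bsub>wreath P A q\<^esub> (w \<otimes>\<^bsub>wreath P A q\<^esub> z)"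
      by (cases v; cases w; cases z)
         (auto simp: wreath_simps P.m_assoc mod_simps add_ac intro!: restrict_ext)
  next
    fix v assume v: "v \<in> carrier (wreath P A q)"
    obtain g u where gu: "v = (g, u)" by (cases v)
    have g: "g \<in> carrier P" and u: "u \<in> (carrier P \<times> A) \<rightarrow>\<^sub>E {..<q}" using v gu by (auto simp: wreath_simps)
    have small: "u (x, a) < q" if "x \<in> carrier P" "a \<in> A" for x a
      using PiE_mem[OF u, of "(x, a)"] that by simp
    show "\<one>\<^bsub>wreath P A q\<^esub> \<otimes>\<^bsub>wreath P A q\<^esub> v = v"
      unfolding gu wreath_simps
    proof (intro prod.inject[THEN iffD2] conjI)
      show "(\<lambda>(x, a)\<in>carrier P \<times> A. (u (x, a) + (\<lambda>_\<in>carrier P \<times> A. 0) (g \<otimes>\<^bsub>P\<^esub> x, a)) mod q) = u"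
        by (rule extensionalityI[of _ "carrier P \<times> A"]) (use u g small in \<open>auto simp: PiE_def\<close>)
    qed (use g in simp)
    \<comment> \<open>The product rule evaluates the left factor at \<open>g \<otimes> x\<close>, so
      the negated function is shifted back by \<open>inv g\<close>. The final \<open>mod q\<close>
      covers the value \<open>q - 0\<close>.\<close>
    let ?w = "(inv\<^bsub>P\<^esub> g, \<lambda>(x, a)\<in>carrier P \<times> A. (q - u (inv\<^bsub>P\<^esub> g \<otimes>\<^bsub>P\<^esub> x, a)) mod q)"
    have "?w \<in> carrier (wreath P A q)" using g q by (auto simp: wreath_simps)
    moreover have "?w \<otimes>\<^bsub>wreath P A q\<^esub> v = \<one>\<^bsub>wreath P A q\<^esub>"
    proof -
      have "(u (x, a) + (q - u (x, a)) mod q) mod q = 0" if "x \<in> carrier P" "a \<in> A" for x a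
        using small[OF that] by (simp add: mod_simps)
      then show ?thesis
        unfolding gu wreath_simps using g
        by (auto simp: P.m_assoc[symmetric] intro!: restrict_ext)
    qed
    ultimately show "\<exists>w\<in>carrier (wreath P A q). w \<otimes>\<^bsub>wreath P A q\<^esub> v = \<one>\<^bsub>wreath P A q\<^esub>" by blast
  qed
qed

lemma order_wreath:
  assumes "finite (carrier P)" "finite A"
  shows "Coset.order (wreath P A q) = card (carrier P) * q ^ (card (carrier P) * card A)"
  using assms by (simp add: Coset.order_def wreath_simps card_cartesian_product card_PiE)

section \<open>Counting coordinates and averaging over cosets\<close>

text \<open>Fixing one coordinate leaves the others free. With \<open>B\<close> of size
  \<open>q\<close> this gives the density \<open>1/q\<close> of vectors about to wrap
  around.\<close>

lemma card_PiE_fixed_value: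
  assumes "finite J" "j \<in> J" "b \<in> B"
  shows "card B * card {f \<in> J \<rightarrow>\<^sub>E B. f j = b} = card (J \<rightarrow>\<^sub>E B)"
proof -
  have "{f \<in> J \<rightarrow>\<^sub>E B. f j = b} = Pi\<^sub>E J (\<lambda>k. if k = j then {b} else B)"
    using assms by (auto simp: PiE_iff extensional_def split: if_splits)
  then have "card {f \<in> J \<rightarrow>\<^sub>E B. f j = b} = (\<Prod>k\<in>J. card (if k = j then {b} else B))"
    using assms by (simp add: card_PiE)
  also have "\<dots> = (\<Prod>k\<in>J - {j}. card (if k = j then {b} else B))"
    using assms by (simp add: prod.remove)
  also have "\<dots> = (\<Prod>k\<in>J - {j}. card B)" by (rule prod.cong) auto
  finally have "card {f \<in> J \<rightarrow>\<^sub>E B. f j = b} = card B ^ (card J - 1)"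
    using assms by simp
  moreover have "card J > 0" using assms card_gt_0_iff by blast
  ultimately show ?thesis using assms by (cases "card J") (simp_all add: card_PiE)
qed

text \<open>Each \<open>w\<close> in \<open>H\<close> yields a map on \<open>G/ker h\<close> by
  restricting \<open>\<Phi>\<close> to the right coset of the image through \<open>w\<close>.
  Averaged over \<open>w\<close>, its defect density is that of \<open>\<Phi>\<close> on
  \<open>H\<close>, so some \<open>w\<close> does no worse. Summing over \<open>i\<close> first
  makes a single \<open>w\<close> serve all generators.\<close>

lemma (in group_hom) average_over_cosets:
  assumes fin: "finite (carrier H)" and s: "\<And>i. i < n \<Longrightarrow> s i \<in> carrier G"
    and \<Phi>: "\<Phi> \<in> carrier H \<rightarrow> D"
  obtains \<phi> where "\<phi> \<in> rcosets (kernel G H h) \<rightarrow> D"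
    "(\<Sum>i<n. card (defect G (kernel G H h) \<phi> (f i) (s i))) * card (carrier H)
      \<le> card (rcosets (kernel G H h)) * (\<Sum>i<n. card {w \<in> carrier H. \<Phi> (h (s i) \<otimes>\<^bsub>H\<^esub> w) \<noteq> f i (\<Phi> w)})"
proof -
  let ?K = "kernel G H h"
  interpret K: normal ?K G by (rule normal_kernel)
  define \<theta> where "\<theta> c = the_elem (h ` c)" for c
  have \<theta>: "\<theta> (?K #> g) = h g" if "g \<in> carrier G" for g
    unfolding \<theta>_def by (rule the_elem_kernel_coset[OF that])
  define bad where "bad i w \<longleftrightarrow> \<Phi> (h (s i) \<otimes>\<^bsub>H\<^esub> w) \<noteq> f i (\<Phi> w)" for i w
  let ?I = "h ` carrier G"
  have finI: "finite ?I" by (rule finite_subset[OF hom_carrier[OF homh] fin])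
  have IH: "x \<in> carrier H" if "x \<in> ?I" for x using that by auto
  have dc: "card (defect G ?K (\<lambda>c. \<Phi> (\<theta> c \<otimes>\<^bsub>H\<^esub> w)) (f i) (s i)) = card {x \<in> ?I. bad i (x \<otimes>\<^bsub>H\<^esub> w)}"
    if w: "w \<in> carrier H" and i: "i < n" for w i
  proof (rule bij_betw_same_card[of \<theta>])
    have eq: "?K #> g \<in> defect G ?K (\<lambda>c. \<Phi> (\<theta> c \<otimes>\<^bsub>H\<^esub> w)) (f i) (s i) \<longleftrightarrow> bad i (h g \<otimes>\<^bsub>H\<^esub> w)"
      if g: "g \<in> carrier G" for g
    proof -
      have "s i <# (?K #> g) = ?K #> (s i \<otimes> g)"
        by (rule G.l_coset_rcoset[OF normal_kernel s[OF i] g])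
      moreover have "?K #> g \<in> rcosets ?K" by (rule G.rcosetsI[OF K.subset g])
      ultimately show ?thesis
        using g s[OF i] w by (simp add: defect_def bad_def \<theta> H.m_assoc)
    qed
    show "bij_betw \<theta> (defect G ?K (\<lambda>c. \<Phi> (\<theta> c \<otimes>\<^bsub>H\<^esub> w)) (f i) (s i)) {x \<in> ?I. bad i (x \<otimes>\<^bsub>H\<^esub> w)}"
      unfolding bij_betw_def
    proof
      have sub: "defect G ?K (\<lambda>c. \<Phi> (\<theta> c \<otimes>\<^bsub>H\<^esub> w)) (f i) (s i) \<subseteq> carrier (G Mod ?K)"
        by (auto simp: defect_def FactGroup_def)
      have "inj_on \<theta> (carrier (G Mod ?K))" unfolding \<theta>_def by (rule FactGroup_inj_on)
      then show "inj_on \<theta> (defect G ?K (\<lambda>c. \<Phi> (\<theta> c \<otimes>\<^bsub>H\<^esub> w)) (f i) (s i))" using sub by (rule inj_on_subset)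
      show "\<theta> ` defect G ?K (\<lambda>c. \<Phi> (\<theta> c \<otimes>\<^bsub>H\<^esub> w)) (f i) (s i) = {x \<in> ?I. bad i (x \<otimes>\<^bsub>H\<^esub> w)}"
      proof (intro equalityI subsetI)
        fix x assume "x \<in> \<theta> ` defect G ?K (\<lambda>c. \<Phi> (\<theta> c \<otimes>\<^bsub>H\<^esub> w)) (f i) (s i)"
        then obtain c where c: "c \<in> defect G ?K (\<lambda>c. \<Phi> (\<theta> c \<otimes>\<^bsub>H\<^esub> w)) (f i) (s i)" "x = \<theta> c" by blast
        then have "c \<in> rcosets ?K" by (simp add: defect_def)
        then obtain g where g: "g \<in> carrier G" "c = ?K #> g" by (rule G.rcosets_obtain)
        show "x \<in> {x \<in> ?I. bad i (x \<otimes>\<^bsub>H\<^esub> w)}" using c g eq[OF g(1)] \<theta>[OF g(1)] by simp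
      next
        fix x assume "x \<in> {x \<in> ?I. bad i (x \<otimes>\<^bsub>H\<^esub> w)}"
        then obtain g where g: "g \<in> carrier G" "x = h g" "bad i (h g \<otimes>\<^bsub>H\<^esub> w)" by blast
        then have "?K #> g \<in> defect G ?K (\<lambda>c. \<Phi> (\<theta> c \<otimes>\<^bsub>H\<^esub> w)) (f i) (s i)" using eq by simp
        then show "x \<in> \<theta> ` defect G ?K (\<lambda>c. \<Phi> (\<theta> c \<otimes>\<^bsub>H\<^esub> w)) (f i) (s i)"
          unfolding g(2) \<theta>[OF g(1), symmetric] by (rule imageI)
      qed
    qed
  qed
  \<comment> \<open>Left translation permutes \<open>H\<close>. Hence the double count of bad pairs
    \<open>(x, w)\<close> is the number of bad \<open>w\<close> times the order of the
    image.\<close>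
  have translate: "card {w \<in> carrier H. bad i (x \<otimes>\<^bsub>H\<^esub> w)} = card {w \<in> carrier H. bad i w}" if x: "x \<in> carrier H" for x i
  proof (rule bij_betw_same_card[of "\<lambda>w. x \<otimes>\<^bsub>H\<^esub> w"], rule bij_betw_byWitness[where f' = "\<lambda>w. inv\<^bsub>H\<^esub> x \<otimes>\<^bsub>H\<^esub> w"])
  qed (use x in \<open>auto simp: H.m_assoc[symmetric]\<close>)
  have double: "(\<Sum>w\<in>carrier H. card {x \<in> ?I. bad i (x \<otimes>\<^bsub>H\<^esub> w)}) = card ?I * card {w \<in> carrier H. bad i w}" for i
  proof -
    have "(\<Sum>w\<in>carrier H. card {x \<in> ?I. bad i (x \<otimes>\<^bsub>H\<^esub> w)}) = (\<Sum>w\<in>carrier H. \<Sum>x\<in>?I. if bad i (x \<otimes>\<^bsub>H\<^esub> w) then 1 else 0)"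
      using finI by (intro sum.cong refl) (simp add: sum.If_cases Int_def)
    also have "\<dots> = (\<Sum>x\<in>?I. \<Sum>w\<in>carrier H. if bad i (x \<otimes>\<^bsub>H\<^esub> w) then 1 else 0)" by (rule sum.swap)
    also have "\<dots> = (\<Sum>x\<in>?I. card {w \<in> carrier H. bad i (x \<otimes>\<^bsub>H\<^esub> w)})"
      using fin by (intro sum.cong refl) (simp add: sum.If_cases Int_def)
    also have "\<dots> = (\<Sum>x\<in>?I. card {w \<in> carrier H. bad i w})"
      by (intro sum.cong refl translate IH)
    finally show ?thesis by simp
  qed
  define T where "T w = (\<Sum>i<n. card {x \<in> ?I. bad i (x \<otimes>\<^bsub>H\<^esub> w)})" for w
  define R where "R = card ?I * (\<Sum>i<n. card {w \<in> carrier H. bad i w})"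
  have tot: "(\<Sum>w\<in>carrier H. T w) = R"
    unfolding T_def R_def sum_distrib_left double[symmetric] by (rule sum.swap)
  have "\<exists>w\<in>carrier H. T w * card (carrier H) \<le> R"
  proof (rule ccontr)
    assume "\<not> ?thesis"
    then have "(\<Sum>w\<in>carrier H. R) < (\<Sum>w\<in>carrier H. T w * card (carrier H))"
      using H.one_closed fin by (intro sum_strict_mono) (auto simp: not_le)
    then show False by (simp add: sum_distrib_right[symmetric] tot mult.commute)
  qed
  then obtain w where w: "w \<in> carrier H" "T w * card (carrier H) \<le> R" by blast
  show ?thesis
  proof (rule that[of "\<lambda>c. \<Phi> (\<theta> c \<otimes>\<^bsub>H\<^esub> w)"])
    show "(\<lambda>c. \<Phi> (\<theta> c \<otimes>\<^bsub>H\<^esub> w)) \<in> rcosets ?K \<rightarrow> D"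
    proof
      fix c assume "c \<in> rcosets ?K"
      then obtain g where "g \<in> carrier G" "c = ?K #> g" by (rule G.rcosets_obtain)
      then show "\<Phi> (\<theta> c \<otimes>\<^bsub>H\<^esub> w) \<in> D" using \<theta> w(1) \<Phi> by (auto intro!: funcset_mem[OF \<Phi>])
    qed
    have "(\<Sum>i<n. card (defect G ?K (\<lambda>c. \<Phi> (\<theta> c \<otimes>\<^bsub>H\<^esub> w)) (f i) (s i))) = T w"
      unfolding T_def by (intro sum.cong refl dc w(1)) simp
    then show "(\<Sum>i<n. card (defect G ?K (\<lambda>c. \<Phi> (\<theta> c \<otimes>\<^bsub>H\<^esub> w)) (f i) (s i))) * card (carrier H)
        \<le> card (rcosets ?K) * (\<Sum>i<n. card {w \<in> carrier H. \<Phi> (h (s i) \<otimes>\<^bsub>H\<^esub> w) \<noteq> f i (\<Phi> w)})"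
      using w(2) by (simp only: R_def bad_def kernel_index)
  qed
qed

text \<open>The lifting property of free groups, restricted to the one type of target groups at which it
  is needed (a locale assumption cannot quantify over types).\<close>

locale lifting_group = group G for G (structure) +
  fixes s :: "nat \<Rightarrow> 'a" and n :: nat
  assumes s_closed: "s i \<in> carrier G"
    and lift: "group (W :: ('a set \<times> ('a set \<times> 'a set \<Rightarrow> nat)) monoid) \<Longrightarrow> \<forall>i. w i \<in> carrier W \<Longrightarrow>
      \<exists>h. group_hom G W h \<and> (\<forall>i<n. h (s i) = w i)"
begin

section \<open>Approximation through one abelian layer\<close>

text \<open>Only the elements \<open>s i\<close> are tested here;
  \<open>free_group_defect_bound\<close> later extends the control to arbitrary words.\<close>

definition p_approximable :: "nat \<Rightarrow> 'a set \<Rightarrow> bool" where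
  "p_approximable p N \<longleftrightarrow> (\<forall>\<epsilon>>0. \<exists>K\<in>p_index_normal G p. \<exists>\<phi>\<in>rcosets K \<rightarrow> rcosets N.
     \<forall>i<n. card (defect G K \<phi> (\<lambda>d. s i <# d) (s i)) \<le> (\<epsilon>::real) * card (rcosets K))"

text \<open>The start of the induction: \<open>G/G\<close> has index \<open>p ^ 0\<close>, and the
  identity map has no defect.\<close>

lemma p_approximable_carrier: "p_approximable p (carrier G)"
  unfolding p_approximable_def
  by (intro allI impI bexI[OF _ carrier_p_index_normal] bexI[of _ "\<lambda>c. c"]) (simp_all add: defect_def)

text \<open>\<open>a b\<close> equals the commutator of \<open>a\<close> and \<open>b\<close> times
  \<open>b a\<close>, and \<open>N\<close> absorbs the commutator. The quotient \<open>L/N\<close>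
  is realised inside \<open>G Mod N\<close>, so its elements are cosets of \<open>N\<close>.\<close>

lemma comm_group_quotient:
  assumes N: "N \<lhd> G" and L: "L \<lhd> G" and sub: "N \<subseteq> L"
    and comm: "\<And>a b. a \<in> L \<Longrightarrow> b \<in> L \<Longrightarrow> a \<otimes> b \<otimes> inv a \<otimes> inv b \<in> N"
  shows "comm_group ((G Mod N)\<lparr>carrier := (\<lambda>l. N #> l) ` L\<rparr>)"
proof -
  interpret N: normal N G by fact
  interpret L: normal L G by fact
  interpret Q: group "G Mod N" by (rule N.factorgroup_is_group)
  interpret \<pi>: group_hom G "G Mod N" "\<lambda>l. N #> l"
    by (rule group_hom.intro[OF is_group Q.is_group group_hom_axioms.intro[OF N.r_coset_hom_Mod]])
  have subg: "subgroup ((\<lambda>l. N #> l) ` L) (G Mod N)"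
    by (rule \<pi>.subgroup_img_is_subgroup[OF L.subgroup_axioms])
  interpret S: group "(G Mod N)\<lparr>carrier := (\<lambda>l. N #> l) ` L\<rparr>"
    by (rule Q.subgroup_imp_group[OF subg])
  show ?thesis
  proof (rule S.group_comm_groupI)
    fix x y assume "x \<in> carrier ((G Mod N)\<lparr>carrier := (\<lambda>l. N #> l) ` L\<rparr>)" "y \<in> carrier ((G Mod N)\<lparr>carrier := (\<lambda>l. N #> l) ` L\<rparr>)"
    then obtain a b where ab: "a \<in> L" "b \<in> L" "x = N #> a" "y = N #> b" by auto
    have G: "a \<in> carrier G" "b \<in> carrier G" using ab L.subset by auto
    have "N #> (b \<otimes> a) = N #> ((a \<otimes> b \<otimes> inv a \<otimes> inv b) \<otimes> (b \<otimes> a))"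
      using coset_mult_assoc[OF N.subset, of "a \<otimes> b \<otimes> inv a \<otimes> inv b" "b \<otimes> a"] N.rcos_const[OF is_group comm[OF ab(1,2)]] G by simp
    also have "(a \<otimes> b \<otimes> inv a \<otimes> inv b) \<otimes> (b \<otimes> a) = a \<otimes> b"
    proof -
      have "(a \<otimes> b \<otimes> inv a \<otimes> inv b) \<otimes> (b \<otimes> a) = a \<otimes> b \<otimes> inv a \<otimes> (inv b \<otimes> b) \<otimes> a"
        using G by (simp only: m_assoc m_closed inv_closed)
      also have "\<dots> = a \<otimes> b \<otimes> (inv a \<otimes> a)" using G by (simp add: m_assoc)
      finally show ?thesis using G by simp
    qed
    finally have eq: "N #> (b \<otimes> a) = N #> (a \<otimes> b)" .
    show "x \<otimes>\<^bsub>(G Mod N)\<lparr>carrier := (\<lambda>l. N #> l) ` L\<rparr>\<^esub> y = y \<otimes>\<^bsub>(G Mod N)\<lparr>carrier := (\<lambda>l. N #> l) ` L\<rparr>\<^esub> x"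
    proof -
      have m: "u \<otimes>\<^bsub>(G Mod N)\<lparr>carrier := (\<lambda>l. N #> l) ` L\<rparr>\<^esub> v = u <#> v" for u v by simp
      show ?thesis unfolding ab(3,4) m N.rcos_sum[OF G] N.rcos_sum[OF G(2,1)] by (rule eq[symmetric])
    qed
  qed
qed

end

text \<open>Describes how multiplying out a vector of exponents reacts when one coordinate grows by
  1 without wrapping around.\<close>

lemma (in comm_group) finprod_pow_increment:
  assumes A: "finite A" "A \<subseteq> carrier G" "a \<in> A"
  shows "finprod G (\<lambda>b. b [^] (z b + (if b = a then 1 else 0) :: nat)) A = a \<otimes> finprod G (\<lambda>b. b [^] z b) A"
proof -
  have c: "b \<in> carrier G" if "b \<in> A" for b using that A by blast
  have "finprod G (\<lambda>b. b [^] (z b + (if b = a then 1 else 0) :: nat)) A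
      = finprod G (\<lambda>b. (if a = b then b else \<one>) \<otimes> b [^] z b) A"
    by (rule finprod_cong') (use c in \<open>auto simp: m_comm\<close>)
  also have "\<dots> = finprod G (\<lambda>b. if a = b then b else \<one>) A \<otimes> finprod G (\<lambda>b. b [^] z b) A"
    by (rule finprod_multf) (use c in auto)
  also have "finprod G (\<lambda>b. if a = b then b else \<one>) A = a"
    using finprod_singleton[of a A "\<lambda>b. b"] A by auto
  finally show ?thesis .
qed

context lifting_group
begin

text \<open>A coset of \<open>N\<close> over \<open>\<phi> x\<close> is \<open>r x\<close> times an
  element of \<open>L/N\<close>, and this element is encoded by exponents on the elements of
  \<open>L/N\<close>. As \<open>L/N\<close> is abelian, the order of the factors does not matter,
  and left multiplication by a generator only increments one exponent.\<close>

lemma p_approximable_step: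
  assumes p: "prime p" and N: "N \<lhd> G" and L: "L \<lhd> G" and sub: "N \<subseteq> L" and finN: "finite (rcosets N)"
    and comm: "\<And>a b. a \<in> L \<Longrightarrow> b \<in> L \<Longrightarrow> a \<otimes> b \<otimes> inv a \<otimes> inv b \<in> N"
    and approx: "p_approximable p L"
  shows "p_approximable p N"
  unfolding p_approximable_def
proof (intro allI impI)
  fix \<epsilon> :: real assume "\<epsilon> > 0"
  \<comment> \<open>Each generator may lose \<open>\<delta>\<close> through the defect of
    \<open>\<phi>\<close> and \<open>\<delta>\<close> through wrap-around. All \<open>n\<close>
    losses are added when averaging; \<open>n + 1\<close> keeps the divisor positive.\<close>
  define \<delta> where "\<delta> = \<epsilon> / (2 * (n + 1))"
  have \<delta>: "\<delta> > 0" "n * (2 * \<delta>) \<le> \<epsilon>" using \<open>\<epsilon> > 0\<close> by (simp_all add: \<delta>_def field_simps)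
  interpret N: normal N G by fact
  interpret L: normal L G by fact
  obtain K \<phi> where K: "K \<in> p_index_normal G p" and \<phi>: "\<phi> \<in> rcosets K \<rightarrow> rcosets L"
    and small: "\<And>i. i < n \<Longrightarrow> card (defect G K \<phi> (\<lambda>d. s i <# d) (s i)) \<le> \<delta> * card (rcosets K)"
    using approx \<delta>(1) unfolding p_approximable_def by blast
  obtain k where nK: "K \<lhd> G" and k: "card (rcosets K) = p ^ k" using K unfolding p_index_normal_def by blast
  interpret K: normal K G by fact
  interpret P: group "G Mod K" by (rule K.factorgroup_is_group)
  have carP: "carrier (G Mod K) = rcosets K" by (simp add: FactGroup_def)
  have finP: "finite (rcosets K)" using k p prime_gt_0_nat by (intro card_ge_0_finite) simp
  have p1: "p > 1" using p prime_gt_1_nat by blast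
  \<comment> \<open>Makes the wrap-around density \<open>1/q\<close> at most \<open>\<delta>\<close>
    while keeping \<open>q\<close> a power of \<open>p\<close>.\<close>
  obtain m where m: "1 / \<delta> < real p ^ m" using real_arch_pow[of "real p"] p1 by auto
  define q where "q = p ^ m"
  have q: "q > 0" "1 \<le> \<delta> * q" using p1 m \<delta>(1) by (auto simp: q_def field_simps)
  let ?A = "(\<lambda>l. N #> l) ` L"
  let ?C = "(G Mod N)\<lparr>carrier := ?A\<rparr>"
  interpret C: comm_group ?C by (rule comm_group_quotient[OF N L sub comm])
  have Ar: "?A \<subseteq> rcosets N" using L.subset rcosetsI[OF N.subset] by blast
  have finA: "finite ?A" using Ar finN finite_subset by blast
  let ?W = "wreath (G Mod K) ?A q"
  interpret W: group ?W by (rule group_wreath[OF P.is_group q(1)])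
  let ?J = "carrier (G Mod K) \<times> ?A"
  have finJ: "finite ?J" using finP finA by (simp add: carP)
  let ?U = "?J \<rightarrow>\<^sub>E {..<q}"
  have finU: "finite ?U" using finJ by (intro finite_PiE) auto
  have carW: "carrier ?W = (rcosets K) \<times> ?U" by (simp add: wreath_simps carP)
  have finW: "finite (carrier ?W)" using finP finU by (simp only: carW finite_cartesian_product)

  define r where "r x = (SOME g. g \<in> carrier G \<and> \<phi> x = L #> g)" for x
  have r: "r x \<in> carrier G" "\<phi> x = L #> r x" if "x \<in> rcosets K" for x
  proof -
    have "\<exists>g. g \<in> carrier G \<and> \<phi> x = L #> g"
      using rcosets_obtain[OF funcset_mem[OF \<phi> that]] by blast
    from someI_ex[OF this] show "r x \<in> carrier G" "\<phi> x = L #> r x" unfolding r_def by blast+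
  qed
  \<comment> \<open>the cocycle; its value lies in \<open>L/N\<close> only when \<open>\<phi>\<close> is equivariant at \<open>x\<close>\<close>
  define a where "a i x = N #> (inv (r (s i <# x)) \<otimes> (s i \<otimes> r x))" for i x
  \<comment> \<open>The cocycle lifted to the free abelian group: over each \<open>x\<close>, the
    value \<open>a i x\<close> becomes the corresponding basis vector, or 0 if it lies outside
    \<open>L/N\<close>. The \<open>mod q\<close> matters for \<open>q = 1\<close>.\<close>
  define w where "w i = (K #> s i, \<lambda>(x, b)\<in>?J. (if b = a i x then 1 else 0) mod q)" for i
  have w: "\<forall>i. w i \<in> carrier ?W"
    using q(1) s_closed rcosetsI[OF K.subset] by (auto simp: w_def carW)
  obtain h where "group_hom G ?W h" and hs: "\<And>i. i < n \<Longrightarrow> h (s i) = w i"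
    using lift[OF W.is_group w] by blast
  interpret h: group_hom G ?W h by fact
  \<comment> \<open>Residues are used as natural exponents, so \<open>\<psi>\<close> is additive
    only as long as no coordinate wraps around.\<close>
  define \<psi> where "\<psi> z = finprod ?C (\<lambda>b. b [^]\<^bsub>?C\<^esub> (z b :: nat)) ?A" for z
  have \<psi>: "\<psi> z \<in> ?A" for z
  proof -
    have "\<psi> z \<in> carrier ?C" unfolding \<psi>_def by (intro C.finprod_closed Pi_I C.nat_pow_closed) simp
    then show ?thesis by simp
  qed
  then have \<psi>r: "\<psi> z \<in> rcosets N" for z using Ar by blast
  \<comment> \<open>Only coordinates over the base point \<open>K\<close> are read: left
    multiplication of \<open>(x, u)\<close> by \<open>w i\<close> adds to them the entries of
    \<open>w i\<close> over \<open>x\<close>.\<close>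
  define \<Phi> where "\<Phi> v = r (fst v) <# \<psi> (\<lambda>b. snd v (K, b))" for v
  have \<Phi>: "\<Phi> \<in> carrier ?W \<rightarrow> rcosets N"
    using l_coset_closed[OF N r(1) \<psi>r] by (auto simp: \<Phi>_def carW)
  have Kin: "K \<in> rcosets K" by (rule K.subgroup_in_rcosets[OF is_group])
  define D where "D i = defect G K \<phi> (\<lambda>d. s i <# d) (s i)" for i
  \<comment> \<open>Equivariance of \<open>\<phi>\<close> at \<open>x\<close> gives
    \<open>s i \<otimes> r x = r (s i <# x) \<otimes> l\<close> with \<open>l\<close> in
    \<open>L\<close>. Without wrap-around, \<open>\<psi>\<close> gains exactly the factor
    \<open>N #> l\<close>, and the two changes combine to translation by \<open>s i\<close>.\<close>
  have step: "\<Phi> (w i \<otimes>\<^bsub>?W\<^esub> (x, u)) = s i <# \<Phi> (x, u)"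
    if x: "x \<in> rcosets K" and u: "u \<in> ?U" and good: "x \<notin> D i" and nov: "a i x \<in> ?A \<Longrightarrow> u (K, a i x) \<noteq> q - 1" for i x u
  proof -
    have sx: "(K #> s i) <#> x = s i <# x"
    proof -
      obtain g where g: "g \<in> carrier G" "x = K #> g" using x by (rule rcosets_obtain)
      then show ?thesis using K.rcos_sum[OF s_closed g(1)] l_coset_rcoset[OF nK s_closed g(1)] by simp
    qed
    have sxr: "s i <# x \<in> rcosets K" by (rule l_coset_closed[OF nK s_closed x])
    have rx: "r x \<in> carrier G" "r (s i <# x) \<in> carrier G" using r x sxr by blast+
    let ?l = "inv (r (s i <# x)) \<otimes> (s i \<otimes> r x)"
    have lG: "?l \<in> carrier G" using rx s_closed by simp
    have "L #> r (s i <# x) = L #> (s i \<otimes> r x)"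
    proof -
      have "\<phi> (s i <# x) = s i <# \<phi> x" using good x unfolding D_def defect_def by blast
      then show ?thesis using r[OF x] r[OF sxr] l_coset_rcoset[OF L s_closed r(1)[OF x]] by simp
    qed
    then have "r (s i <# x) <# L = (s i \<otimes> r x) <# L" using L.coset_eq rx s_closed by simp
    then have "s i \<otimes> r x \<in> r (s i <# x) <# L"
      using L.one_closed rx s_closed unfolding l_coset_def by force
    then obtain l where l: "l \<in> L" "s i \<otimes> r x = r (s i <# x) \<otimes> l" unfolding l_coset_def by blast
    then have "?l = l" using rx L.subset by (simp add: inv_solve_left' subsetD)
    then have aA: "a i x \<in> ?A" using l(1) unfolding a_def by blast
    let ?z = "\<lambda>b. u (K, b)"
    have K1: "\<one>\<^bsub>G Mod K\<^esub> = K" by simp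
    have xK: "x <#> K = x" using P.r_one[of x] x by (simp add: carP)
    \<comment> \<open>An entry other than \<open>q - 1\<close> stays below \<open>q\<close> after
      adding 1, so the reduction modulo \<open>q\<close> does nothing.\<close>
    have coord: "snd (w i \<otimes>\<^bsub>?W\<^esub> (x, u)) (K, b) = ?z b + (if b = a i x then 1 else 0)" if b: "b \<in> ?A" for b
    proof -
      have "u (K, b) < q" using PiE_mem[OF u, of "(K, b)"] b Kin by (simp add: carP)
      moreover have "b = a i x \<Longrightarrow> u (K, b) \<noteq> q - 1" using nov aA by blast
      ultimately have "(u (K, b) + (if b = a i x then 1 else 0) mod q) mod q = u (K, b) + (if b = a i x then 1 else 0)"
        using mod_add_right_eq[of "u (K, b)" "if b = a i x then 1 else 0" q] by (cases "b = a i x") auto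
      then show ?thesis
        using b x Kin xK by (simp add: w_def wreath_simps carP)
    qed
    have "\<psi> (\<lambda>b. snd (w i \<otimes>\<^bsub>?W\<^esub> (x, u)) (K, b)) = finprod ?C (\<lambda>b. b [^]\<^bsub>?C\<^esub> (?z b + (if b = a i x then 1 else 0))) ?A"
      unfolding \<psi>_def
    proof (rule C.finprod_cong'[OF refl])
      show "(\<lambda>b. b [^]\<^bsub>?C\<^esub> (?z b + (if b = a i x then 1 else 0))) \<in> ?A \<rightarrow> carrier ?C"
        by (intro Pi_I C.nat_pow_closed) simp
    qed (simp only: coord)
    also have "\<dots> = a i x \<otimes>\<^bsub>?C\<^esub> \<psi> ?z"
      unfolding \<psi>_def by (rule C.finprod_pow_increment) (use finA aA in auto)
    also have "\<dots> = ?l <# \<psi> ?z"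
    proof -
      obtain g where g: "g \<in> carrier G" "\<psi> ?z = N #> g" using \<psi>r by (rule rcosets_obtain)
      then show ?thesis using N.rcos_sum[OF lG g(1)] l_coset_rcoset[OF N lG g(1)] by (simp add: a_def)
    qed
    finally have "\<Phi> (w i \<otimes>\<^bsub>?W\<^esub> (x, u)) = r (s i <# x) <# (?l <# \<psi> ?z)"
      using sx by (simp add: \<Phi>_def w_def wreath_simps)
    also have "\<dots> = (r (s i <# x) \<otimes> ?l) <# \<psi> ?z" by (rule l_coset_mult[OF N \<psi>r rx(2) lG])
    also have "r (s i <# x) \<otimes> ?l = s i \<otimes> r x"
      using rx s_closed by (simp add: m_assoc[symmetric])
    also have "(s i \<otimes> r x) <# \<psi> ?z = s i <# \<Phi> (x, u)"
      using l_coset_mult[OF N \<psi>r s_closed rx(1)] by (simp add: \<Phi>_def)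
    finally show ?thesis .
  qed
  have bad: "real (card {v \<in> carrier ?W. \<Phi> (h (s i) \<otimes>\<^bsub>?W\<^esub> v) \<noteq> s i <# \<Phi> v}) \<le> 2 * \<delta> * card (carrier ?W)" if i: "i < n" for i
  proof -
    \<comment> \<open>The vectors that wrap around over \<open>x\<close>. This set is empty if
      \<open>a i x\<close> is outside \<open>L/N\<close>, and otherwise has density
      \<open>1/q\<close>.\<close>
    define V where "V x = {u \<in> ?U. a i x \<in> ?A \<and> u (K, a i x) = q - 1}" for x
    have "{v \<in> carrier ?W. \<Phi> (h (s i) \<otimes>\<^bsub>?W\<^esub> v) \<noteq> s i <# \<Phi> v} \<subseteq> D i \<times> ?U \<union> (SIGMA x:rcosets K. V x)"
    proof
      fix v assume v: "v \<in> {v \<in> carrier ?W. \<Phi> (h (s i) \<otimes>\<^bsub>?W\<^esub> v) \<noteq> s i <# \<Phi> v}"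
      obtain x u where xu: "v = (x, u)" by (cases v)
      have x: "x \<in> rcosets K" and u: "u \<in> ?U" and ne: "\<Phi> (w i \<otimes>\<^bsub>?W\<^esub> (x, u)) \<noteq> s i <# \<Phi> (x, u)"
        using v hs[OF i] by (simp_all add: carW xu)
      have "x \<in> D i \<or> u \<in> V x"
      proof (rule ccontr)
        assume "\<not> (x \<in> D i \<or> u \<in> V x)"
        then have "x \<notin> D i" "a i x \<in> ?A \<Longrightarrow> u (K, a i x) \<noteq> q - 1" using u unfolding V_def by blast+
        from step[OF x u this] ne show False by contradiction
      qed
      then show "v \<in> D i \<times> ?U \<union> (SIGMA x:rcosets K. V x)" using x u xu by blast
    qed
    moreover have Dsub: "D i \<subseteq> rcosets K" by (auto simp: D_def defect_def)
    have finD: "finite (D i)" by (rule finite_subset[OF Dsub finP])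
    have finO: "finite (V x)" for x by (rule finite_subset[OF _ finU]) (auto simp: V_def)
    ultimately have "card {v \<in> carrier ?W. \<Phi> (h (s i) \<otimes>\<^bsub>?W\<^esub> v) \<noteq> s i <# \<Phi> v} \<le> card (D i \<times> ?U \<union> (SIGMA x:rcosets K. V x))"
      using finU finP finD by (intro card_mono finite_UnI finite_cartesian_product finite_SigmaI) auto
    also have "\<dots> \<le> card (D i \<times> ?U) + card (SIGMA x:rcosets K. V x)" by (rule card_Un_le)
    also have "\<dots> = card (D i) * card ?U + (\<Sum>x\<in>rcosets K. card (V x))"
      using finP finO by (simp add: card_cartesian_product)
    finally have le: "real (card {v \<in> carrier ?W. \<Phi> (h (s i) \<otimes>\<^bsub>?W\<^esub> v) \<noteq> s i <# \<Phi> v})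
        \<le> real (card (D i)) * card ?U + (\<Sum>x\<in>rcosets K. real (card (V x)))"
      unfolding of_nat_sum[symmetric] of_nat_mult[symmetric] of_nat_add[symmetric] of_nat_le_iff .
    have Ocard: "real (card (V x)) \<le> \<delta> * card ?U" for x
    proof (cases "a i x \<in> ?A")
      case True
      have "card {..<q} * card (V x) = card ?U"
        unfolding V_def using True card_PiE_fixed_value[OF finJ, of "(K, a i x)" "q - 1" "{..<q}"] q(1) Kin by (simp add: carP)
      then have "real q * card (V x) = card ?U" by (metis card_lessThan of_nat_mult)
      moreover have "1 * real (card (V x)) \<le> (\<delta> * q) * card (V x)" by (rule mult_right_mono[OF q(2)]) simp
      ultimately show ?thesis by (simp add: mult.assoc)
    next
      case False
      then show ?thesis using \<delta>(1) by (simp add: V_def)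
    qed
    have "(\<Sum>x\<in>rcosets K. real (card (V x))) \<le> card (rcosets K) * (\<delta> * card ?U)"
      by (rule sum_bounded_above[OF Ocard])
    moreover have "real (card (D i)) * card ?U \<le> (\<delta> * card (rcosets K)) * card ?U"
      using small[OF i] by (intro mult_right_mono) (simp_all add: D_def)
    moreover have "real (card (carrier ?W)) = real (card (rcosets K)) * card ?U"
      by (simp add: carW card_cartesian_product)
    ultimately show ?thesis using le by (simp add: algebra_simps)
  qed
  \<comment> \<open>Passes from the whole wreath product to the image of \<open>h\<close>, which
    need not be all of it.\<close>
  obtain \<phi>' where \<phi>': "\<phi>' \<in> rcosets (kernel G ?W h) \<rightarrow> rcosets N"
    and sum: "(\<Sum>i<n. card (defect G (kernel G ?W h) \<phi>' (\<lambda>d. s i <# d) (s i))) * card (carrier ?W)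
      \<le> card (rcosets (kernel G ?W h)) * (\<Sum>i<n. card {v \<in> carrier ?W. \<Phi> (h (s i) \<otimes>\<^bsub>?W\<^esub> v) \<noteq> s i <# \<Phi> v})"
    using h.average_over_cosets[OF finW _ \<Phi>, where n = n and s = s and f = "\<lambda>i d. s i <# d"] s_closed by blast
  have "Coset.order ?W = p ^ (k + m * (card (rcosets K) * card ?A))"
    using order_wreath[of "G Mod K" ?A q] finP finA k by (simp add: carP q_def power_add power_mult)
  then have Kp: "kernel G ?W h \<in> p_index_normal G p" by (rule h.kernel_p_index_normal[OF p])
  have W0: "real (card (carrier ?W)) > 0" using finW W.one_closed card_gt_0_iff by (metis empty_iff of_nat_0_less_iff)
  have "card (defect G (kernel G ?W h) \<phi>' (\<lambda>d. s i <# d) (s i)) \<le> \<epsilon> * card (rcosets (kernel G ?W h))" if i: "i < n" for i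
  proof -
    let ?d = "\<lambda>i. card (defect G (kernel G ?W h) \<phi>' (\<lambda>d. s i <# d) (s i))"
    let ?b = "\<lambda>i. card {v \<in> carrier ?W. \<Phi> (h (s i) \<otimes>\<^bsub>?W\<^esub> v) \<noteq> s i <# \<Phi> v}"
    \<comment> \<open>Averaging controls only the sum of the defects, so each one is bounded by the
      sum.\<close>
    have "?d i \<le> (\<Sum>i<n. ?d i)" using i by (intro member_le_sum) auto
    then have "?d i * card (carrier ?W) \<le> card (rcosets (kernel G ?W h)) * (\<Sum>i<n. ?b i)"
      using sum by (meson mult_le_mono1 order_trans)
    then have "real (?d i) * card (carrier ?W) \<le> card (rcosets (kernel G ?W h)) * (\<Sum>i<n. real (?b i))"
      unfolding of_nat_sum[symmetric] of_nat_mult[symmetric] of_nat_le_iff .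
    also have "\<dots> \<le> card (rcosets (kernel G ?W h)) * (n * (2 * \<delta> * card (carrier ?W)))"
    proof (rule mult_left_mono)
      have "(\<Sum>i<n. real (?b i)) \<le> (\<Sum>i<n. 2 * \<delta> * card (carrier ?W))" by (intro sum_mono bad) simp
      then show "(\<Sum>i<n. real (?b i)) \<le> n * (2 * \<delta> * card (carrier ?W))" by simp
    qed simp
    also have "\<dots> = (n * (2 * \<delta>)) * card (rcosets (kernel G ?W h)) * card (carrier ?W)" by (simp only: mult_ac)
    also have "\<dots> \<le> \<epsilon> * card (rcosets (kernel G ?W h)) * card (carrier ?W)"
      by (intro mult_right_mono \<delta>(2)) simp_all
    finally show ?thesis using W0 by (rule mult_right_le_imp_le)
  qed
  then show "\<exists>K\<in>p_index_normal G p. \<exists>\<phi>\<in>rcosets K \<rightarrow> rcosets N.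
      \<forall>i<n. card (defect G K \<phi> (\<lambda>d. s i <# d) (s i)) \<le> \<epsilon> * card (rcosets K)"
    by (intro bexI[OF _ Kp] bexI[OF _ \<phi>'] allI impI)
qed

end

section \<open>From generators to arbitrary words\<close>

context group
begin

text \<open>If \<open>\<phi>\<close> intertwines \<open>h\<close> at \<open>c\<close> and
  \<open>g\<close> at \<open>h <# c\<close>, it intertwines the product at \<open>c\<close>.
  Translation by \<open>h\<close> is injective, so the second kind of failure is counted by the
  defect of \<open>g\<close>.\<close>

lemma card_defect_mult:
  assumes K: "K \<lhd> G" "finite (rcosets K)" and N: "N \<lhd> G" and \<phi>: "\<phi> \<in> rcosets K \<rightarrow> rcosets N"
    and g: "g \<in> carrier G" "h \<in> carrier G"
  shows "card (defect G K \<phi> (\<lambda>d. (g \<otimes> h) <# d) (g \<otimes> h))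
    \<le> card (defect G K \<phi> (\<lambda>d. g <# d) g) + card (defect G K \<phi> (\<lambda>d. h <# d) h)"
proof -
  let ?D = "\<lambda>g. defect G K \<phi> (\<lambda>d. g <# d) g"
  let ?X = "{c \<in> rcosets K. h <# c \<in> ?D g}"
  have fin: "finite (?D x)" for x using K(2) by (simp add: defect_def)
  have "?D (g \<otimes> h) \<subseteq> ?X \<union> ?D h"
  proof
    fix c assume c: "c \<in> ?D (g \<otimes> h)"
    then have cK: "c \<in> rcosets K" and ne: "\<phi> ((g \<otimes> h) <# c) \<noteq> (g \<otimes> h) <# \<phi> c" by (simp_all add: defect_def)
    have hc: "h <# c \<in> rcosets K" by (rule l_coset_closed[OF K(1) g(2) cK])
    have "\<phi> c \<in> rcosets N" using \<phi> cK by (rule funcset_mem)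
    then have "\<phi> (g <# (h <# c)) \<noteq> g <# (h <# \<phi> c)"
      using ne l_coset_mult[OF K(1) cK g] l_coset_mult[OF N _ g] by simp
    then show "c \<in> ?X \<union> ?D h"
      using cK hc by (cases "\<phi> (h <# c) = h <# \<phi> c") (simp_all add: defect_def)
  qed
  then have "card (?D (g \<otimes> h)) \<le> card (?X \<union> ?D h)"
    using fin K(2) by (intro card_mono) auto
  also have "\<dots> \<le> card ?X + card (?D h)" by (rule card_Un_le)
  also have "card ?X \<le> card (?D g)"
  proof (rule card_inj_on_le[OF _ _ fin])
    show "inj_on (\<lambda>c. h <# c) ?X"
      using bij_betw_imp_inj_on[OF l_coset_bij[OF K(1) g(2)]] by (rule inj_on_subset) blast
  qed blast
  finally show ?thesis by simp
qed

text \<open>Translation by \<open>inv g\<close> injects the defect of \<open>inv g\<close> into that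
  of \<open>g\<close>.\<close>

lemma card_defect_inv:
  assumes K: "K \<lhd> G" "finite (rcosets K)" and N: "N \<lhd> G" and \<phi>: "\<phi> \<in> rcosets K \<rightarrow> rcosets N"
    and g: "g \<in> carrier G"
  shows "card (defect G K \<phi> (\<lambda>d. inv g <# d) (inv g)) \<le> card (defect G K \<phi> (\<lambda>d. g <# d) g)"
proof (rule card_inj_on_le[of "\<lambda>c. inv g <# c"])
  show "inj_on (\<lambda>c. inv g <# c) (defect G K \<phi> (\<lambda>d. inv g <# d) (inv g))"
    using bij_betw_imp_inj_on[OF l_coset_bij[OF K(1) inv_closed[OF g]]] by (rule inj_on_subset) (auto simp: defect_def)
  show "finite (defect G K \<phi> (\<lambda>d. g <# d) g)" using K(2) by (simp add: defect_def)
  show "(\<lambda>c. inv g <# c) ` defect G K \<phi> (\<lambda>d. inv g <# d) (inv g) \<subseteq> defect G K \<phi> (\<lambda>d. g <# d) g"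
  proof
    fix c' assume "c' \<in> (\<lambda>c. inv g <# c) ` defect G K \<phi> (\<lambda>d. inv g <# d) (inv g)"
    then obtain c where c: "c \<in> rcosets K" "\<phi> (inv g <# c) \<noteq> inv g <# \<phi> c" "c' = inv g <# c"
      unfolding defect_def by blast
    have c': "c' \<in> rcosets K" unfolding c(3) by (rule l_coset_closed[OF K(1) inv_closed[OF g] c(1)])
    have "g <# c' = c" unfolding c(3) by (rule l_coset_inv(2)[OF K(1) c(1) g])
    moreover have "inv g <# (g <# \<phi> c') = \<phi> c'"
      by (rule l_coset_inv(1)[OF N funcset_mem[OF \<phi> c'] g])
    ultimately have "\<phi> (g <# c') \<noteq> g <# \<phi> c'" using c(2,3) by metis
    then show "c' \<in> defect G K \<phi> (\<lambda>d. g <# d) g" using c' by (simp add: defect_def)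
  qed
qed

lemma finite_rcosets_supergroup:
  assumes "N \<lhd> G" "L \<lhd> G" "N \<subseteq> L" "finite (rcosets N)"
  shows "finite (rcosets L)"
proof (rule finite_subset[OF _ finite_imageI[OF assms(4), of "\<lambda>c. L <#> c"]])
  show "rcosets L \<subseteq> (\<lambda>c. L <#> c) ` (rcosets N)"
  proof
    fix c assume "c \<in> rcosets L"
    then obtain g where g: "g \<in> carrier G" "c = L #> g" by (rule rcosets_obtain)
    have "c = L <#> (N #> g)"
      using set_mult_r_coset_sub[OF normal_imp_subgroup normal_imp_subgroup] assms g by simp
    moreover have "N #> g \<in> rcosets N"
      by (rule rcosetsI[OF subgroup.subset[OF normal_imp_subgroup[OF assms(1)]] g(1)])
    ultimately show "c \<in> (\<lambda>c. L <#> c) ` (rcosets N)" by (rule image_eqI)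
  qed
qed

end

section \<open>Induction along the derived series\<close>

lemma (in group_hom) normal_vimage:
  assumes "D \<lhd> H"
  shows "{g \<in> carrier G. h g \<in> D} \<lhd> G"
proof -
  interpret D: normal D H by fact
  show ?thesis
    unfolding G.normal_inv_iff
  proof (intro conjI ballI)
    show "subgroup {g \<in> carrier G. h g \<in> D} G"
      by (rule G.subgroupI) (auto intro: exI[of _ \<one>])
  qed (auto simp: D.inv_op_closed2)
qed

context lifting_group
begin

text \<open>The preimages \<open>L m\<close> of the derived series of \<open>G/N\<close> descend
  from \<open>G\<close> to \<open>N\<close>, and commutators of \<open>L m\<close> lie in
  \<open>L (Suc m)\<close>, so \<open>p_approximable_step\<close> applies to each consecutive
  pair.\<close>

lemma p_approximable_solv_normal:
  assumes p: "prime p" and N: "N \<in> solv_normal G"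
  shows "p_approximable p N"
proof -
  have nN: "N \<lhd> G" and fin: "finite (rcosets N)" and sol: "solvable (G Mod N)"
    using N by (simp_all add: solv_normal_def FactGroup_def)
  interpret N: normal N G by fact
  interpret Q: group "G Mod N" by (rule N.factorgroup_is_group)
  interpret \<pi>: group_hom G "G Mod N" "\<lambda>g. N #> g"
    by (rule group_hom.intro[OF is_group Q.is_group group_hom_axioms.intro[OF N.r_coset_hom_Mod]])
  define D where "D m = (derived (G Mod N) ^^ m) (carrier (G Mod N))" for m
  define L where "L m = {g \<in> carrier G. N #> g \<in> D m}" for m
  have nD: "D m \<lhd> (G Mod N)" for m
    by (induction m) (simp_all add: D_def Q.normal_self Q.derived_is_normal)
  have nL: "L m \<lhd> G" for m unfolding L_def by (rule \<pi>.normal_vimage[OF nD])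
  have Nself: "N #> g = N" if "g \<in> N" for g using N.rcos_const[OF is_group that] .
  have NL: "N \<subseteq> L m" for m
  proof
    fix g assume g: "g \<in> N"
    have "N \<in> D m" using subgroup.one_closed[OF normal_imp_subgroup[OF nD]] by simp
    then show "g \<in> L m" using g Nself by (simp add: L_def)
  qed
  have "p_approximable p (L m)" for m
  proof (induction m)
    case 0
    have "L 0 = carrier G" by (auto simp: L_def D_def carrier_FactGroup)
    then show ?case using p_approximable_carrier by simp
  next
    case (Suc m)
    have comm: "a \<otimes> b \<otimes> inv a \<otimes> inv b \<in> L (Suc m)" if ab: "a \<in> L m" "b \<in> L m" for a b
    proof -
      have G: "a \<in> carrier G" "b \<in> carrier G" and D: "N #> a \<in> D m" "N #> b \<in> D m" using ab by (auto simp: L_def)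
      have "N #> (a \<otimes> b \<otimes> inv a \<otimes> inv b)
          = (N #> a) \<otimes>\<^bsub>G Mod N\<^esub> (N #> b) \<otimes>\<^bsub>G Mod N\<^esub> inv\<^bsub>G Mod N\<^esub> (N #> a) \<otimes>\<^bsub>G Mod N\<^esub> inv\<^bsub>G Mod N\<^esub> (N #> b)"
        using G by (simp only: \<pi>.hom_mult m_closed inv_closed \<pi>.hom_inv)
      also have "\<dots> \<in> derived (G Mod N) (D m)"
        unfolding derived_def by (rule generate.incl) (use D in blast)
      finally show ?thesis using G by (simp add: L_def D_def)
    qed
    have "L (Suc m) \<subseteq> L m"
    proof -
      have "D (Suc m) = derived (G Mod N) (D m)" by (simp add: D_def)
      also have "\<dots> \<subseteq> D m"
        by (rule Q.derived_incl[OF order_refl normal_imp_subgroup[OF nD]])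
      finally show ?thesis by (auto simp: L_def)
    qed
    then show ?case
      using p_approximable_step[OF p nL nL _ finite_rcosets_supergroup[OF nN nL NL fin] comm Suc] by blast
  qed
  moreover obtain m where "D m = {\<one>\<^bsub>G Mod N\<^esub>}"
    using sol unfolding Q.solvable_iff_trivial_derived_seq D_def by blast
  moreover from this have "L m \<subseteq> N"
    using rcos_self[OF _ N.subgroup_axioms] by (auto simp: L_def)
  ultimately show ?thesis using NL by (metis subset_antisym)
qed

end

section \<open>Free groups and the two weak containments\<close>

text \<open>Word evaluation provides the homomorphism. Indices from \<open>n\<close> on go to the
  empty word, so that the total function \<open>s\<close> stays inside the group.\<close>

lemma lifting_group_free_group:
  "lifting_group (free_group n) (\<lambda>i. if i < n then gen i else []) n"
proof (intro lifting_group.intro lifting_group_axioms.intro group_free_group)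
  show "(if i < n then gen i else []) \<in> carrier (free_group n)" for i
    by (simp add: free_group_simps)
  fix W :: "((nat \<times> bool) list set \<times> ((nat \<times> bool) list set \<times> (nat \<times> bool) list set \<Rightarrow> nat)) monoid" and w :: "nat \<Rightarrow> _"
  assume W: "group W" and w: "\<forall>i. w i \<in> carrier W"
  show "\<exists>h. group_hom (free_group n) W h \<and> (\<forall>i<n. h (if i < n then gen i else []) = w i)"
    using group.word_eval_hom[OF W w] group.word_eval_gen[OF W] w
    by (intro exI[of _ "group.word_eval W w"]) simp
qed

text \<open>The constant counts the letters of \<open>w\<close> and is fixed before
  \<open>K\<close>, \<open>\<phi>\<close> and \<open>\<delta>\<close>, so the accuracy required on
  generators can be chosen from \<open>w\<close> alone.\<close>

lemma free_group_defect_bound: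
  assumes "w \<in> carrier (free_group n)" and N: "N \<lhd> free_group n"
  shows "\<exists>C::nat. \<forall>K \<phi> (\<delta>::real). K \<lhd> free_group n \<longrightarrow> finite (rcosets\<^bsub>free_group n\<^esub> K) \<longrightarrow>
    \<phi> \<in> rcosets\<^bsub>free_group n\<^esub> K \<rightarrow> rcosets\<^bsub>free_group n\<^esub> N \<longrightarrow>
    (\<forall>i<n. card (defect (free_group n) K \<phi> (\<lambda>d. gen i <#\<^bsub>free_group n\<^esub> d) (gen i)) \<le> \<delta>) \<longrightarrow>
    card (defect (free_group n) K \<phi> (\<lambda>d. w <#\<^bsub>free_group n\<^esub> d) w) \<le> C * \<delta>"
  using assms(1)
proof (induction rule: free_group_induct)
  case one
  interpret group "free_group n" by (rule group_free_group)
  have "defect (free_group n) K \<phi> (\<lambda>d. [] <#\<^bsub>free_group n\<^esub> d) [] = {}"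
    if "K \<lhd> free_group n" "\<phi> \<in> rcosets\<^bsub>free_group n\<^esub> K \<rightarrow> rcosets\<^bsub>free_group n\<^esub> N" for K \<phi>
    using l_coset_one[OF that(1)] l_coset_one[OF N] funcset_mem[OF that(2)]
    by (auto simp: defect_def free_group_simps)
  then show ?case by (intro exI[of _ 0]) simp
next
  case (mult s w)
  interpret group "free_group n" by (rule group_free_group)
  let ?D = "\<lambda>K \<phi> g. card (defect (free_group n) K \<phi> (\<lambda>d. g <#\<^bsub>free_group n\<^esub> d) g)"
  obtain i where i: "i < n" "s = gen i \<or> s = inv\<^bsub>free_group n\<^esub> gen i" using mult by blast
  obtain C :: nat where C: "\<And>K \<phi> (\<delta>::real). K \<lhd> free_group n \<Longrightarrow> finite (rcosets\<^bsub>free_group n\<^esub> K) \<Longrightarrow>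
    \<phi> \<in> rcosets\<^bsub>free_group n\<^esub> K \<rightarrow> rcosets\<^bsub>free_group n\<^esub> N \<Longrightarrow> \<forall>i<n. ?D K \<phi> (gen i) \<le> \<delta> \<Longrightarrow> ?D K \<phi> w \<le> C * \<delta>"
    using mult.IH by blast
  have gi: "gen i \<in> carrier (free_group n)" by (rule gen_carrier[OF i(1)])
  then have s: "s \<in> carrier (free_group n)" using i(2) by auto
  show ?case
  proof (intro exI[of _ "Suc C"] allI impI)
    fix K \<phi> and \<delta> :: real
    assume K: "K \<lhd> free_group n" "finite (rcosets\<^bsub>free_group n\<^esub> K)"
      and \<phi>: "\<phi> \<in> rcosets\<^bsub>free_group n\<^esub> K \<rightarrow> rcosets\<^bsub>free_group n\<^esub> N"
      and small: "\<forall>i<n. ?D K \<phi> (gen i) \<le> \<delta>"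
    have "?D K \<phi> s \<le> ?D K \<phi> (gen i)" using i(2) card_defect_inv[OF K N \<phi> gi] by auto
    then have "real (?D K \<phi> s) \<le> \<delta>" using small i(1) by (meson of_nat_mono order_trans)
    moreover have "real (?D K \<phi> w) \<le> C * \<delta>" by (rule C[OF K \<phi> small])
    moreover have "?D K \<phi> (s \<otimes>\<^bsub>free_group n\<^esub> w) \<le> ?D K \<phi> s + ?D K \<phi> w"
      by (rule card_defect_mult[OF K N \<phi> s mult.hyps(2)])
    ultimately show "?D K \<phi> (s \<otimes>\<^bsub>free_group n\<^esub> w) \<le> Suc C * \<delta>" by (simp add: algebra_simps)
  qed
qed

theorem theorem10:
  fixes p n :: nat
  assumes "prime p"
  shows "weakly_equivalent (free_group n)
           (comp_act (free_group n) (p_index_normal (free_group n) p))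
           (haar (free_group n) (p_index_normal (free_group n) p))
           (comp_act (free_group n) (solv_normal (free_group n)))
           (haar (free_group n) (solv_normal (free_group n)))"
proof -
  let ?F = "free_group n"
  interpret F: lifting_group ?F "\<lambda>i. if i < n then gen i else []" n by (rule lifting_group_free_group)
  interpret P: profinite_family ?F "p_index_normal ?F p" by (rule F.profinite_family_p_index_normal[OF assms])
  interpret S: profinite_family ?F "solv_normal ?F" by (rule F.profinite_family_solv_normal)
  have "weakly_contains ?F (comp_act ?F (p_index_normal ?F p)) (haar ?F (p_index_normal ?F p))
      (comp_act ?F (solv_normal ?F)) (haar ?F (solv_normal ?F))"
  proof (rule F.weakly_contains_profinite[OF P.profinite_family_axioms S.profinite_family_axioms P.is_haar_haar S.is_haar_haar])
    fix N E and \<epsilon> :: real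
    assume N: "N \<in> solv_normal ?F" and E: "finite E" "E \<subseteq> carrier ?F" and "0 < \<epsilon>"
    note nN = S.normal[OF N]
    have "\<forall>w. \<exists>C::nat. w \<in> E \<longrightarrow> (\<forall>K \<phi> (\<delta>::real). K \<lhd> ?F \<longrightarrow> finite (rcosets\<^bsub>?F\<^esub> K) \<longrightarrow>
        \<phi> \<in> rcosets\<^bsub>?F\<^esub> K \<rightarrow> rcosets\<^bsub>?F\<^esub> N \<longrightarrow>
        (\<forall>i<n. card (defect ?F K \<phi> (\<lambda>d. gen i <#\<^bsub>?F\<^esub> d) (gen i)) \<le> \<delta>) \<longrightarrow>
        card (defect ?F K \<phi> (\<lambda>d. w <#\<^bsub>?F\<^esub> d) w) \<le> C * \<delta>)"
      using free_group_defect_bound[OF subsetD[OF E(2)] nN] by blast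
    from choice[OF this] obtain C :: "_ \<Rightarrow> nat" where
      C: "\<And>w K \<phi> (\<delta>::real). w \<in> E \<Longrightarrow> K \<lhd> ?F \<Longrightarrow> finite (rcosets\<^bsub>?F\<^esub> K) \<Longrightarrow>
        \<phi> \<in> rcosets\<^bsub>?F\<^esub> K \<rightarrow> rcosets\<^bsub>?F\<^esub> N \<Longrightarrow>
        \<forall>i<n. card (defect ?F K \<phi> (\<lambda>d. gen i <#\<^bsub>?F\<^esub> d) (gen i)) \<le> \<delta> \<Longrightarrow>
        card (defect ?F K \<phi> (\<lambda>d. w <#\<^bsub>?F\<^esub> d) w) \<le> C w * \<delta>"
      by blast
    \<comment> \<open>One bound for all words in \<open>E\<close>; the summand 1 keeps it positive
      when \<open>E\<close> is empty.\<close>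
    define M where "M = (\<Sum>w\<in>E. C w) + 1"
    have CM: "real (C w) \<le> M" if "w \<in> E" for w
      unfolding of_nat_le_iff using member_le_sum[of w E C] that E(1) by (simp add: M_def)
    have M: "real M > 0" unfolding of_nat_0_less_iff by (simp add: M_def)
    have "F.p_approximable p N" by (rule F.p_approximable_solv_normal[OF assms N])
    moreover have "\<epsilon> / M > 0" using \<open>0 < \<epsilon>\<close> M by simp
    ultimately obtain K \<phi> where K: "K \<in> p_index_normal ?F p" and \<phi>: "\<phi> \<in> rcosets\<^bsub>?F\<^esub> K \<rightarrow> rcosets\<^bsub>?F\<^esub> N"
      and small: "\<forall>i<n. card (defect ?F K \<phi> (\<lambda>d. (if i < n then gen i else []) <#\<^bsub>?F\<^esub> d) (if i < n then gen i else []))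
        \<le> \<epsilon> / M * card (rcosets\<^bsub>?F\<^esub> K)"
      unfolding F.p_approximable_def by blast
    have small': "\<forall>i<n. card (defect ?F K \<phi> (\<lambda>d. gen i <#\<^bsub>?F\<^esub> d) (gen i)) \<le> \<epsilon> / M * card (rcosets\<^bsub>?F\<^esub> K)"
      using small by simp
    have "card (defect ?F K \<phi> (\<lambda>d. w <#\<^bsub>?F\<^esub> d) w) \<le> \<epsilon> * card (rcosets\<^bsub>?F\<^esub> K)" if w: "w \<in> E" for w
    proof -
      have "card (defect ?F K \<phi> (\<lambda>d. w <#\<^bsub>?F\<^esub> d) w) \<le> C w * (\<epsilon> / M * card (rcosets\<^bsub>?F\<^esub> K))"
        by (rule C[OF w P.normal[OF K] P.finite_index[OF K] \<phi> small'])
      also have "\<dots> \<le> M * (\<epsilon> / M * card (rcosets\<^bsub>?F\<^esub> K))"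
        by (rule mult_right_mono[OF CM[OF w]]) (use \<open>0 < \<epsilon>\<close> M in simp)
      also have "\<dots> = \<epsilon> * card (rcosets\<^bsub>?F\<^esub> K)" using M by simp
      finally show ?thesis .
    qed
    then show "\<exists>K\<in>p_index_normal ?F p. \<exists>\<phi>\<in>rcosets\<^bsub>?F\<^esub> K \<rightarrow> rcosets\<^bsub>?F\<^esub> N.
        \<forall>g\<in>E. card (defect ?F K \<phi> (\<lambda>d. g <#\<^bsub>?F\<^esub> d) g) \<le> \<epsilon> * card (rcosets\<^bsub>?F\<^esub> K)"
      using K \<phi> by blast
  qed
  moreover have "weakly_contains ?F (comp_act ?F (solv_normal ?F)) (haar ?F (solv_normal ?F))
      (comp_act ?F (p_index_normal ?F p)) (haar ?F (p_index_normal ?F p))"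
  proof (rule F.weakly_contains_profinite[OF S.profinite_family_axioms P.profinite_family_axioms S.is_haar_haar P.is_haar_haar])
    fix N E and \<epsilon> :: real
    assume N: "N \<in> p_index_normal ?F p" and "0 < \<epsilon>"
    have "N \<in> solv_normal ?F" using F.p_index_normal_subset_solv_normal[OF assms] N by blast
    then show "\<exists>K\<in>solv_normal ?F. \<exists>\<phi>\<in>rcosets\<^bsub>?F\<^esub> K \<rightarrow> rcosets\<^bsub>?F\<^esub> N.
        \<forall>g\<in>E. card (defect ?F K \<phi> (\<lambda>d. g <#\<^bsub>?F\<^esub> d) g) \<le> \<epsilon> * card (rcosets\<^bsub>?F\<^esub> K)"
      \<comment> \<open>The quotient by \<open>N\<close> belongs to both systems, and the identity
        map has empty defect.\<close>
      using \<open>0 < \<epsilon>\<close> by (intro bexI[of _ N] bexI[of _ "\<lambda>c. c"]) (simp_all add: defect_def)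
  qed
  ultimately show ?thesis by (simp add: weakly_equivalent_def)
qed

end
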